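(* Fix $n\ge0$ and let $\mathcal{F}_n$ be the set of (isomorphism classes of) interval orders on $n$ elements. There is an involution $\phi:\mathcal{F}_n\to\mathcal{F}_n$ such that, if $R\in\mathcal{F}_n$ has F1-triple $(T_1,S_1,R)$ and F2-triple $(T_2,S_2,R)$, and $R'=\phi(R)$ has F1-triple $(T_1',S_1',R')$ and F2-triple $(T_2',S_2',R')$, then $\mathrm{max}(S_1)=\mathrm{max}(T_2')$ (hence $\mathrm{max}(T_2)=\mathrm{max}(S_1')$), $\mathrm{max}(S_2)=\mathrm{max}(T_1')$ (hence $\mathrm{max}(T_1)=\mathrm{max}(S_2')$), and $\mathrm{max}(R)=\mathrm{max}(R')$. In particular the pairs of statistics $(\mathrm{max}(S_1),\mathrm{max}(T_2))$ and $(\mathrm{max}(S_2),\mathrm{max}(T_1))$ both have symmetric joint distribution on $\mathcal{F}_n$.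
   Context: For a relation $Q$ on $X$, $x$ is $Q$-maximal if there is no $y$ with $xQy$; $\mathrm{max}(Q)$ is the number of $Q$-maximal elements. An interval order is a $\mathbf{2+2}$-free poset (no four elements with only the relations $a<b$, $c<d$). It has a unique minimal interval representation $x\mapsto[l_x,r_x]$ with positive integer endpoints, $x\prec y$ iff $r_x<l_y$, every $k\in\{1,\dots,m\}$ both a left and a right endpoint; its Fishburn matrix $M$ is $m\times m$ with $M_{i,j}=|\{x:[l_x,r_x]=[i,j]\}|$ (rows top to bottom), $x$ represented by cell $c_x=(i,j)$, $X_c$ the set of elements represented by $c$. For cells $c=(i,j)$, $c'=(i',j')$: $c$ greater than $c'$ if $j'<i$, comparable if one is greater; South $i>i'$, $j=j'$; North $i<i'$, $j=j'$; West $i=i'$, $j<j'$; strictly SW $i>i'$, $j<j'$; strictly NW: incomparable with $i<i'$, $j<j'$; weakly SW: South, West or strictly SW; weakly NW: North, West or strictly NW. The F1-triple $(T_1,S_1,R)$: for $x,y$ in distinct cells, $xT_1y$ iff $c_x$ strictly NW from $c_y$, $xS_1y$ iff $c_x$ weakly SW from $c_y$; on each $X_c$, $S_1$ restricts to a linear order and $T_1$ has no pairs. The F2-triple $(T_2,S_2,R)$: for $x,y$ in distinct cells, $xT_2y$ iff $c_x$ weakly NW from $c_y$, $xS_2y$ iff $c_x$ strictly SW from $c_y$; on each $X_c$, $T_2$ restricts to a linear order and $S_2$ has no pairs. Statistics $f,g$ have symmetric joint distribution on a set $\mathcal{A}$ if $|\{a: f(a)=k, g(a)=\ell\}|=|\{a: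 f(a)=\ell, g(a)=k\}|$ for all $k,\ell$. *)

theory Defs
  imports Main
begin

text \<open>A relation \<open>Q\<close> is a set of pairs, with \<open>(x, y) \<in> Q\<close> for \<open>x Q y\<close>.\<close>

definition num_maximal :: "'a set \<Rightarrow> 'a rel \<Rightarrow> nat" where
  "num_maximal A Q = card {x \<in> A. \<not> (\<exists>y\<in>A. (x, y) \<in> Q)}"

definition interval_order_on :: "'a set \<Rightarrow> 'a rel \<Rightarrow> bool" where
  "interval_order_on A R \<longleftrightarrow>
     R \<subseteq> A \<times> A \<and> irrefl R \<and> trans R \<and>
     \<not> (\<exists>a\<in>A. \<exists>b\<in>A. \<exists>c\<in>A. \<exists>d\<in>A. distinct [a, b, c, d] \<and>
          Restr R {a, b, c, d} = {(a, b), (c, d)})"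

text \<open>\<open>l x\<close> and \<open>r x\<close> are the endpoints of the interval of \<open>x\<close>; \<open>m\<close> is the number of
  rows of the Fishburn matrix.\<close>

definition minimal_interval_rep ::
    "'a set \<Rightarrow> 'a rel \<Rightarrow> nat \<Rightarrow> ('a \<Rightarrow> nat) \<Rightarrow> ('a \<Rightarrow> nat) \<Rightarrow> bool" where
  "minimal_interval_rep A R m l r \<longleftrightarrow>
     (\<forall>x\<in>A. l x \<le> r x) \<and>
     (\<forall>x\<in>A. \<forall>y\<in>A. (x, y) \<in> R \<longleftrightarrow> r x < l y) \<and>
     l ` A = {1..m} \<and> r ` A = {1..m}"

text \<open>A cell is a pair (row, column), rows being numbered from top to bottom.\<close>

type_synonym cell = "nat \<times> nat"

definition cell_greater :: "cell \<Rightarrow> cell \<Rightarrow> bool" where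
  "cell_greater c c' \<longleftrightarrow> snd c' < fst c"

definition cell_comparable :: "cell \<Rightarrow> cell \<Rightarrow> bool" where
  "cell_comparable c c' \<longleftrightarrow> cell_greater c c' \<or> cell_greater c' c"

definition South :: "cell \<Rightarrow> cell \<Rightarrow> bool" where
  "South c c' \<longleftrightarrow> fst c > fst c' \<and> snd c = snd c'"

definition North :: "cell \<Rightarrow> cell \<Rightarrow> bool" where
  "North c c' \<longleftrightarrow> fst c < fst c' \<and> snd c = snd c'"

definition West :: "cell \<Rightarrow> cell \<Rightarrow> bool" where
  "West c c' \<longleftrightarrow> fst c = fst c' \<and> snd c < snd c'"

definition strictly_SW :: "cell \<Rightarrow> cell \<Rightarrow> bool" where
  "strictly_SW c c' \<longleftrightarrow> fst c > fst c' \<and> snd c < snd c'"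

definition strictly_NW :: "cell \<Rightarrow> cell \<Rightarrow> bool" where
  "strictly_NW c c' \<longleftrightarrow> \<not> cell_comparable c c' \<and> fst c < fst c' \<and> snd c < snd c'"

definition weakly_SW :: "cell \<Rightarrow> cell \<Rightarrow> bool" where
  "weakly_SW c c' \<longleftrightarrow> South c c' \<or> West c c' \<or> strictly_SW c c'"

definition weakly_NW :: "cell \<Rightarrow> cell \<Rightarrow> bool" where
  "weakly_NW c c' \<longleftrightarrow> North c c' \<or> West c c' \<or> strictly_NW c c'"

definition elems_of_cell :: "'a set \<Rightarrow> ('a \<Rightarrow> nat) \<Rightarrow> ('a \<Rightarrow> nat) \<Rightarrow> cell \<Rightarrow> 'a set" where
  "elems_of_cell A l r c = {x \<in> A. (l x, r x) = c}"

text \<open>The linear orders inside the cells may be chosen freely, so an interval order has several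
  F1-triples and F2-triples. The minimal representation is unique on \<open>A\<close>, see
  \<open>minimal_interval_rep_exists\<close> and \<open>minimal_interval_rep_unique\<close> below.\<close>

definition F1_triple :: "'a set \<Rightarrow> 'a rel \<Rightarrow> 'a rel \<Rightarrow> 'a rel \<Rightarrow> bool" where
  "F1_triple A T S R \<longleftrightarrow>
     T \<subseteq> A \<times> A \<and> S \<subseteq> A \<times> A \<and>
     (\<exists>m l r. minimal_interval_rep A R m l r \<and>
        (\<forall>x\<in>A. \<forall>y\<in>A. (l x, r x) \<noteq> (l y, r y) \<longrightarrow>
           ((x, y) \<in> T \<longleftrightarrow> strictly_NW (l x, r x) (l y, r y)) \<and>
           ((x, y) \<in> S \<longleftrightarrow> weakly_SW (l x, r x) (l y, r y))) \<and>
        (\<forall>c. strict_linear_order_on (elems_of_cell A l r c) (Restr S (elems_of_cell A l r c)) \<and>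
             Restr T (elems_of_cell A l r c) = {}))"

definition F2_triple :: "'a set \<Rightarrow> 'a rel \<Rightarrow> 'a rel \<Rightarrow> 'a rel \<Rightarrow> bool" where
  "F2_triple A T S R \<longleftrightarrow>
     T \<subseteq> A \<times> A \<and> S \<subseteq> A \<times> A \<and>
     (\<exists>m l r. minimal_interval_rep A R m l r \<and>
        (\<forall>x\<in>A. \<forall>y\<in>A. (l x, r x) \<noteq> (l y, r y) \<longrightarrow>
           ((x, y) \<in> T \<longleftrightarrow> weakly_NW (l x, r x) (l y, r y)) \<and>
           ((x, y) \<in> S \<longleftrightarrow> strictly_SW (l x, r x) (l y, r y))) \<and>
        (\<forall>c. strict_linear_order_on (elems_of_cell A l r c) (Restr T (elems_of_cell A l r c)) \<and>
             Restr S (elems_of_cell A l r c) = {}))"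

text \<open>The isomorphism classes of interval orders with \<open>n\<close> elements, every such order being
  isomorphic to one with ground set \<open>{..<n}\<close>.\<close>

definition iso_rel :: "nat \<Rightarrow> nat rel rel" where
  "iso_rel n = {(R, R'). interval_order_on {..<n} R \<and> interval_order_on {..<n} R' \<and>
     (\<exists>f. bij_betw f {..<n} {..<n} \<and>
        (\<forall>x<n. \<forall>y<n. (x, y) \<in> R \<longleftrightarrow> (f x, f y) \<in> R'))}"

definition interval_orders :: "nat \<Rightarrow> nat rel set set" where
  "interval_orders n = {R. interval_order_on {..<n} R} // iso_rel n"

text \<open>The numbers of maximal elements as statistics on isomorphism classes: they depend neither
  on the representative nor on the linear orders chosen inside the cells.\<close>

definition max_S1 :: "nat \<Rightarrow> nat rel set \<Rightarrow> nat" where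
  "max_S1 n C = (THE k. \<exists>R\<in>C. \<exists>T S. F1_triple {..<n} T S R \<and> k = num_maximal {..<n} S)"

definition max_T1 :: "nat \<Rightarrow> nat rel set \<Rightarrow> nat" where
  "max_T1 n C = (THE k. \<exists>R\<in>C. \<exists>T S. F1_triple {..<n} T S R \<and> k = num_maximal {..<n} T)"

definition max_S2 :: "nat \<Rightarrow> nat rel set \<Rightarrow> nat" where
  "max_S2 n C = (THE k. \<exists>R\<in>C. \<exists>T S. F2_triple {..<n} T S R \<and> k = num_maximal {..<n} S)"

definition max_T2 :: "nat \<Rightarrow> nat rel set \<Rightarrow> nat" where
  "max_T2 n C = (THE k. \<exists>R\<in>C. \<exists>T S. F2_triple {..<n} T S R \<and> k = num_maximal {..<n} T)"

definition symmetric_joint_distribution :: "'c set \<Rightarrow> ('c \<Rightarrow> nat) \<Rightarrow> ('c \<Rightarrow> nat) \<Rightarrow> bool" where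
  "symmetric_joint_distribution \<A> f g \<longleftrightarrow>
     (\<forall>k l. card {a \<in> \<A>. f a = k \<and> g a = l} = card {a \<in> \<A>. f a = l \<and> g a = k})"

lemma interval_order_predecessors_chain:
  assumes "interval_order_on A R" "x \<in> A" "y \<in> A"
  shows "{z. (z, x) \<in> R} \<subseteq> {z. (z, y) \<in> R} \<or> {z. (z, y) \<in> R} \<subseteq> {z. (z, x) \<in> R}"
proof (rule ccontr)
  assume "\<not> ?thesis"
  then obtain a c where h: "(a, x) \<in> R" "(a, y) \<notin> R" "(c, y) \<in> R" "(c, x) \<notin> R"
    by blast
  have tr: "\<And>u v w. (u, v) \<in> R \<Longrightarrow> (v, w) \<in> R \<Longrightarrow> (u, w) \<in> R"
    and ir: "\<And>u. (u, u) \<notin> R" and sub: "R \<subseteq> A \<times> A"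
    using assms(1) by (auto simp: interval_order_on_def irrefl_def dest: transD)
  have dist: "distinct [a, x, c, y]"
    using h tr ir by auto
  have "(a, c) \<notin> R" "(c, a) \<notin> R" using h tr by blast+
  moreover have "(x, y) \<notin> R" "(y, x) \<notin> R" using h tr by blast+
  moreover have "(x, a) \<notin> R" "(y, c) \<notin> R" using h tr ir by blast+
  moreover have "(x, c) \<notin> R" "(y, a) \<notin> R" using h tr by blast+
  ultimately have "Restr R {a, x, c, y} = {(a, x), (c, y)}"
    using h ir by auto
  moreover have "a \<in> A" "c \<in> A" using h sub by auto
  ultimately have "\<exists>a\<in>A. \<exists>b\<in>A. \<exists>c\<in>A. \<exists>d\<in>A. distinct [a, b, c, d] \<and>
      Restr R {a, b, c, d} = {(a, b), (c, d)}"
    using assms(2,3) dist by (intro bexI conjI)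
  then show False
    using assms(1) by (simp add: interval_order_on_def)
qed

lemma chain_rank_image:
  assumes "finite \<D>" "\<And>E F. E \<in> \<D> \<Longrightarrow> F \<in> \<D> \<Longrightarrow> E \<subseteq> F \<or> F \<subseteq> E"
  shows "(\<lambda>E. card {F \<in> \<D>. F \<subseteq> E}) ` \<D> = {1..card \<D>}"
proof (rule card_subset_eq)
  let ?f = "\<lambda>E. card {F \<in> \<D>. F \<subseteq> E}"
  have mono: "?f E < ?f F" if "E \<in> \<D>" "F \<in> \<D>" "E \<subset> F" for E F
    using that assms(1) by (intro psubset_card_mono) auto
  have "inj_on ?f \<D>"
  proof (rule inj_onI, rule ccontr)
    fix E F assume *: "E \<in> \<D>" "F \<in> \<D>" "?f E = ?f F" "E \<noteq> F"
    then have "E \<subset> F \<or> F \<subset> E" using assms(2) by blast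
    with mono *(1-3) show False by force
  qed
  then show "card (?f ` \<D>) = card {1..card \<D>}" by (simp add: card_image)
  show "?f ` \<D> \<subseteq> {1..card \<D>}"
  proof (rule image_subsetI)
    fix E assume "E \<in> \<D>"
    then have "{F \<in> \<D>. F \<subseteq> E} \<noteq> {}" by auto
    then have "0 < ?f E" using assms(1) by (simp add: card_gt_0_iff)
    moreover have "?f E \<le> card \<D>" using assms(1) by (intro card_mono) auto
    ultimately show "?f E \<in> {1..card \<D>}" by simp
  qed
qed simp

lemma minimal_interval_rep_exists:
  assumes fin: "finite A" and R: "interval_order_on A R"
  shows "\<exists>m l r. minimal_interval_rep A R m l r"
proof -
  define D where "D = (\<lambda>x. {z. (z, x) \<in> R})"
  define \<D> where "\<D> = D ` A"
  define l where "l = (\<lambda>x. card {F \<in> \<D>. F \<subseteq> D x})"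
  define r where "r = (\<lambda>x. card {F \<in> \<D>. x \<notin> F})"
  have fD: "finite \<D>" using fin by (simp add: \<D>_def)
  have tr: "\<And>u v w. (u, v) \<in> R \<Longrightarrow> (v, w) \<in> R \<Longrightarrow> (u, w) \<in> R"
    and ir: "\<And>u. (u, u) \<notin> R" and sub: "R \<subseteq> A \<times> A"
    using R by (auto simp: interval_order_on_def irrefl_def dest: transD)
  have chain: "E \<subseteq> F \<or> F \<subseteq> E" if "E \<in> \<D>" "F \<in> \<D>" for E F
    using that interval_order_predecessors_chain[OF R] by (auto simp: \<D>_def D_def)
  have DA: "D x \<in> \<D>" if "x \<in> A" for x using that by (simp add: \<D>_def)
  have lr: "l x \<le> r x" for x
    unfolding l_def r_def using fD ir by (intro card_mono) (auto simp: D_def)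
  have iff: "(x, y) \<in> R \<longleftrightarrow> r x < l y" if "x \<in> A" "y \<in> A" for x y
  proof
    assume "(x, y) \<in> R"
    then have "x \<in> D y" by (simp add: D_def)
    then have "{F \<in> \<D>. x \<notin> F} \<subset> {F \<in> \<D>. F \<subseteq> D y}"
      using chain DA[OF that(2)] by blast
    then show "r x < l y" unfolding l_def r_def using fD by (intro psubset_card_mono) auto
  next
    assume less: "r x < l y"
    show "(x, y) \<in> R"
    proof (rule ccontr)
      assume "(x, y) \<notin> R"
      then have "l y \<le> r x"
        unfolding l_def r_def using fD by (intro card_mono) (auto simp: D_def)
      with less show False by simp
    qed
  qed
  have limg: "l ` A = {1..card \<D>}"
    using chain_rank_image[OF fD chain] by (simp add: l_def \<D>_def image_image)
  have rimg: "r ` A = {1..card \<D>}"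
  proof
    show "r ` A \<subseteq> {1..card \<D>}"
    proof (rule image_subsetI)
      fix x assume "x \<in> A"
      then have "1 \<le> l x" using limg by auto
      moreover have "r x \<le> card \<D>" unfolding r_def using fD by (intro card_mono) auto
      ultimately show "r x \<in> {1..card \<D>}" using lr[of x] by simp
    qed
    show "{1..card \<D>} \<subseteq> r ` A"
    proof
      fix k assume k: "k \<in> {1..card \<D>}"
      then obtain y where y: "y \<in> A" "l y = k" using limg by (metis imageE)
      show "k \<in> r ` A"
      proof (cases "\<exists>F\<in>\<D>. D y \<subset> F")
        case True
        define G where "G = \<Inter>{F \<in> \<D>. D y \<subset> F}"
        have G: "G \<in> \<D> \<and> D y \<subset> G"
        proof -
          have "finite {F \<in> \<D>. D y \<subset> F}" "{F \<in> \<D>. D y \<subset> F} \<noteq> {}" using fD True by auto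
          then obtain M where M: "M \<in> {F \<in> \<D>. D y \<subset> F}"
            "\<And>F. F \<in> {F \<in> \<D>. D y \<subset> F} \<Longrightarrow> F \<subseteq> M \<Longrightarrow> F = M"
            using finite_has_minimal by (metis (no_types, lifting))
          then have "G = M" unfolding G_def using chain by blast
          then show ?thesis using M(1) by simp
        qed
        then obtain x where x: "x \<in> G" "x \<notin> D y" by blast
        have "x \<in> A" using x G sub by (auto simp: \<D>_def D_def)
        moreover have "{F \<in> \<D>. x \<notin> F} = {F \<in> \<D>. F \<subseteq> D y}"
          using x chain[OF _ DA[OF y(1)]] unfolding G_def by blast
        ultimately show ?thesis
          using y(2) unfolding r_def l_def by (metis (no_types, lifting) imageI)
      next
        case False
        then have "{F \<in> \<D>. F \<subseteq> D y} = \<D>" "{F \<in> \<D>. y \<notin> F} = \<D>"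
          using chain[OF _ DA[OF y(1)]] ir by (auto simp: D_def)
        then have "r y = k" using y(2) unfolding r_def l_def by simp
        then show ?thesis using y(1) by blast
      qed
    qed
  qed
  show ?thesis
    using lr iff limg rimg unfolding minimal_interval_rep_def by blast
qed

lemma minimal_interval_rep_card:
  assumes "minimal_interval_rep A R m l r" "x \<in> A"
  shows "l x = card ((\<lambda>y. {z \<in> A. (z, y) \<in> R}) ` {y \<in> A. {z \<in> A. (z, y) \<in> R} \<subseteq> {z \<in> A. (z, x) \<in> R}})"
    and "r x = card ((\<lambda>y. {z \<in> A. (z, y) \<in> R}) ` {y \<in> A. (x, y) \<notin> R})"
    and "m = card ((\<lambda>y. {z \<in> A. (z, y) \<in> R}) ` A)"
proof -
  define D where "D = (\<lambda>y. {z \<in> A. (z, y) \<in> R})"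
  have R: "(u, v) \<in> R \<longleftrightarrow> r u < l v" if "u \<in> A" "v \<in> A" for u v
    using that assms(1) unfolding minimal_interval_rep_def by blast
  have img: "l ` A = {1..m}" "r ` A = {1..m}"
    using assms(1) by (simp_all add: minimal_interval_rep_def)
  have D_le: "D u \<subseteq> D v \<longleftrightarrow> l u \<le> l v" if "u \<in> A" "v \<in> A" for u v
  proof
    assume sub: "D u \<subseteq> D v"
    show "l u \<le> l v"
    proof (rule ccontr)
      assume "\<not> l u \<le> l v"
      moreover have "l v \<in> r ` A" using img that by blast
      then obtain z where "z \<in> A" "r z = l v" by force
      ultimately have "z \<in> D u" "z \<notin> D v" using R that by (auto simp: D_def)
      with sub show False by blast
    qed
  qed (use R that in \<open>auto simp: D_def\<close>)
  have D_eq: "D u = D v \<longleftrightarrow> l u = l v" if "u \<in> A" "v \<in> A" for u v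
    using D_le[OF that] D_le[OF that(2) that(1)] by auto
  have card_eq: "card (D ` B) = card (l ` B)" if "B \<subseteq> A" for B
  proof -
    define h where "h = (\<lambda>k. D (SOME v. v \<in> B \<and> l v = k))"
    have h: "h (l u) = D u" if "u \<in> B" for u
    proof -
      have "(SOME v. v \<in> B \<and> l v = l u) \<in> B \<and> l (SOME v. v \<in> B \<and> l v = l u) = l u"
        by (rule someI_ex) (use that in blast)
      then show ?thesis unfolding h_def using D_eq \<open>B \<subseteq> A\<close> that by blast
    qed
    have "inj_on h (l ` B)"
    proof (rule inj_onI)
      fix a b assume "a \<in> l ` B" "b \<in> l ` B" "h a = h b"
      then obtain u v where uv: "u \<in> B" "v \<in> B" "a = l u" "b = l v" by blast
      then have "D u = D v" using h \<open>h a = h b\<close> by simp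
      then show "a = b" using D_eq uv \<open>B \<subseteq> A\<close> by blast
    qed
    moreover have "h ` l ` B = D ` B" using h by (auto simp: image_image)
    ultimately show ?thesis by (metis card_image)
  qed
  have below: "l ` {y \<in> A. l y \<le> k} = {1..k}" if "k \<le> m" for k
  proof -
    have "l ` {y \<in> A. l y \<le> k} = l ` A \<inter> {..k}" by auto
    also have "\<dots> = {1..k}" using that img(1) by auto
    finally show ?thesis .
  qed
  have "l x \<in> {1..m}" using img(1) assms(2) by blast
  then have lm: "l x \<le> m" by simp
  have "r x \<in> {1..m}" using img(2) assms(2) by blast
  then have rm: "r x \<le> m" by simp
  have "{y \<in> A. D y \<subseteq> D x} = {y \<in> A. l y \<le> l x}" using D_le assms(2) by auto
  then have "card (D ` {y \<in> A. D y \<subseteq> D x}) = l x"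
    using card_eq[of "{y \<in> A. l y \<le> l x}"] below[OF lm] by auto
  then show "l x = card ((\<lambda>y. {z \<in> A. (z, y) \<in> R}) ` {y \<in> A. {z \<in> A. (z, y) \<in> R} \<subseteq> {z \<in> A. (z, x) \<in> R}})"
    by (simp add: D_def)
  have "{y \<in> A. (x, y) \<notin> R} = {y \<in> A. l y \<le> r x}" using R assms(2) by auto
  then have "card (D ` {y \<in> A. (x, y) \<notin> R}) = r x"
    using card_eq[of "{y \<in> A. l y \<le> r x}"] below[OF rm] by auto
  then show "r x = card ((\<lambda>y. {z \<in> A. (z, y) \<in> R}) ` {y \<in> A. (x, y) \<notin> R})"
    by (simp add: D_def)
  show "m = card ((\<lambda>y. {z \<in> A. (z, y) \<in> R}) ` A)"
    using card_eq[of A] img by (simp add: D_def)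
qed

lemma minimal_interval_rep_unique:
  assumes "minimal_interval_rep A R m l r" "minimal_interval_rep A R m' l' r'"
  shows "m = m' \<and> (\<forall>x\<in>A. l x = l' x \<and> r x = r' x)"
proof (cases "A = {}")
  case True
  then have "{1..m} = {}" "{1..m'} = {}"
    using assms by (simp_all add: minimal_interval_rep_def)
  then show ?thesis using True by simp
next
  case False
  then obtain a where "a \<in> A" by blast
  then have "m = m'"
    using minimal_interval_rep_card(3)[OF assms(1)] minimal_interval_rep_card(3)[OF assms(2)]
    by simp
  moreover have "l x = l' x" "r x = r' x" if "x \<in> A" for x
    unfolding minimal_interval_rep_card(1,2)[OF assms(1) that]
      minimal_interval_rep_card(1,2)[OF assms(2) that] by (rule refl)+
  ultimately show ?thesis by blast
qed

lemma F1_F2_triple_exist: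
  fixes R :: "nat rel"
  assumes "interval_order_on {..<n} R"
  shows "\<exists>T S. F1_triple {..<n} T S R" "\<exists>T S. F2_triple {..<n} T S R"
proof -
  let ?A = "{..<n}"
  obtain m l r where rep: "minimal_interval_rep ?A R m l r"
    using minimal_interval_rep_exists[OF _ assms] by blast
  define c where "c = (\<lambda>x. (l x, r x))"
  define lin :: "(cell \<Rightarrow> cell \<Rightarrow> bool) \<Rightarrow> nat rel" where
    "lin P = {(x, y). x < n \<and> y < n \<and> (if c x = c y then x < y else P (c x) (c y))}" for P
  define emp :: "(cell \<Rightarrow> cell \<Rightarrow> bool) \<Rightarrow> nat rel" where
    "emp P = {(x, y). x < n \<and> y < n \<and> c x \<noteq> c y \<and> P (c x) (c y)}" for P
  have elems: "elems_of_cell ?A l r d = {x. x < n \<and> c x = d}" for d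
    by (auto simp: elems_of_cell_def c_def)
  have "Restr (lin P) {x. x < n \<and> c x = d} = {(x, y). x < n \<and> y < n \<and> c x = d \<and> c y = d \<and> x < y}"
    for P d by (auto simp: lin_def)
  then have lin: "strict_linear_order_on (elems_of_cell ?A l r d) (Restr (lin P) (elems_of_cell ?A l r d))"
    for P d
    unfolding elems by (auto simp: strict_linear_order_on_def total_on_def intro!: transI irreflI)
  have emp: "Restr (emp P) (elems_of_cell ?A l r d) = {}" for P d
    unfolding elems by (auto simp: emp_def)
  have mem: "(x, y) \<in> lin P \<longleftrightarrow> P (l x, r x) (l y, r y)" "(x, y) \<in> emp P \<longleftrightarrow> P (l x, r x) (l y, r y)"
    if "x \<in> ?A" "y \<in> ?A" "(l x, r x) \<noteq> (l y, r y)" for x y P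
    using that by (simp_all add: lin_def emp_def c_def del: prod.inject)
  have sub: "lin P \<subseteq> ?A \<times> ?A" "emp P \<subseteq> ?A \<times> ?A" for P
    by (auto simp: lin_def emp_def)
  have "F1_triple ?A (emp strictly_NW) (lin weakly_SW) R"
    unfolding F1_triple_def
    by (intro conjI sub, rule exI[of _ m], rule exI[of _ l], rule exI[of _ r])
      (intro conjI allI ballI impI rep lin emp mem)
  then show "\<exists>T S. F1_triple {..<n} T S R" by blast
  have "F2_triple ?A (lin weakly_NW) (emp strictly_SW) R"
    unfolding F2_triple_def
    by (intro conjI sub, rule exI[of _ m], rule exI[of _ l], rule exI[of _ r])
      (intro conjI allI ballI impI rep lin emp mem)
  then show "\<exists>T S. F2_triple {..<n} T S R" by blast
qed

end

theory Submission
  imports Defs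
begin

text \<open>Call row \<open>i \<le> j\<close> live at column \<open>j\<close> if it has a nonzero entry in some column \<open>\<ge> j\<close>. Building
  the Fishburn matrix column by column, the rows live at \<open>j + 1\<close> are the diagonal row \<open>j + 1\<close>
  together with an arbitrary subset of the rows live at \<open>j\<close>. The involution reads each column in
  reverse along its live rows and likewise reverses the choice of the rows that stay live. A
  nonzero cell \<open>(i, j)\<close> has no nonzero cell weakly north-east of it iff \<open>i\<close> is the topmost live row
  at \<open>j\<close> and dies there. It has no other nonzero incomparable cell weakly south-east of it iff
  \<open>i\<close> is the bottommost live row at \<open>j\<close> and dies there, because the rows born later are comparable
  to the cell. The strict versions say that no row above (below) \<open>i\<close> survives column \<open>j\<close>. Hence the
  reversal exchanges the two kinds of statistics, and it preserves all column sums, in particular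
  that of the last column, which is the number of maximal elements of the order.\<close>

section \<open>Order-reversing bijections of finite sets\<close>

text \<open>For finite \<open>A\<close> and \<open>B\<close> of equal size this is the only
  decreasing bijection from \<open>A\<close> to \<open>B\<close>: the rank of \<open>x\<close>
  counted from below in \<open>A\<close> is read off as a rank counted from above in
  \<open>B\<close>.\<close>

definition reversal :: "nat set \<Rightarrow> nat set \<Rightarrow> nat \<Rightarrow> nat" where
  "reversal A B x = rev (sorted_list_of_set B) ! card {a \<in> A. a < x}"

lemma card_below_less:
  fixes A :: "nat set"
  assumes "finite A" "x \<in> A" "x < y"
  shows "card {a \<in> A. a < x} < card {a \<in> A. a < y}"
proof (rule psubset_card_mono)
  show "{a \<in> A. a < x} \<subset> {a \<in> A. a < y}" using assms(2,3) by auto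
qed (use assms(1) in simp)

lemma reversal_bij_antimono:
  assumes "finite A" "finite B" "card A = card B"
  shows "bij_betw (reversal A B) A B" and "monotone_on A (<) (>) (reversal A B)"
proof -
  let ?xs = "rev (sorted_list_of_set B)"
  have less: "card {a \<in> A. a < x} < length ?xs" if "x \<in> A" for x
  proof -
    have "card {a \<in> A. a < x} < card A"
      using that assms(1) by (intro psubset_card_mono) auto
    then show ?thesis using assms by simp
  qed
  have sorted: "sorted_wrt (>) ?xs"
    by (simp add: sorted_wrt_rev)
  show anti: "monotone_on A (<) (>) (reversal A B)"
  proof (rule monotone_onI)
    fix x y assume "x \<in> A" "y \<in> A" "x < y"
    then show "reversal A B x > reversal A B y"
      unfolding reversal_def
      using sorted_wrt_nth_less[OF sorted card_below_less[OF assms(1)] less] by blast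
  qed
  have inj: "inj_on (reversal A B) A"
    using anti by (intro linorder_inj_onI) (auto dest: monotone_onD)
  have "reversal A B x \<in> B" if "x \<in> A" for x
    using nth_mem[OF less[OF that]] assms(2) by (simp add: reversal_def)
  then have "reversal A B ` A \<subseteq> B" by blast
  then have "reversal A B ` A = B"
    using assms card_image[OF inj] by (intro card_subset_eq) auto
  with inj show "bij_betw (reversal A B) A B" by (simp add: bij_betw_def)
qed

text \<open>An increasing bijection of \<open>A\<close> onto itself preserves the number of elements
  of \<open>A\<close> below a point, and by \<open>card_below_less\<close> this rank determines the
  point.\<close>

lemma strict_mono_bij_finite_eq:
  fixes A :: "nat set"
  assumes "finite A" "bij_betw g A A" "monotone_on A (<) (<) g" "x \<in> A"
  shows "g x = x"
proof -
  have iff: "g a < g b \<longleftrightarrow> a < b" if "a \<in> A" "b \<in> A" for a b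
    using that monotone_onD[OF assms(3), of a b] monotone_onD[OF assms(3), of b a]
    by (metis less_asym linorder_neqE_nat)
  have gA: "g ` A = A" and inj: "inj_on g A" using assms(2) by (auto simp: bij_betw_def)
  have "g ` {a \<in> A. a < x} = {a \<in> A. a < g x}"
  proof (intro equalityI subsetI)
    fix b assume b: "b \<in> {a \<in> A. a < g x}"
    then obtain a where "a \<in> A" "b = g a" using gA by blast
    with b show "b \<in> g ` {a \<in> A. a < x}" using iff assms(4) by auto
  qed (use iff gA assms(4) in auto)
  moreover have "inj_on g {a \<in> A. a < x}" using inj by (rule inj_on_subset) auto
  ultimately have eq: "card {a \<in> A. a < g x} = card {a \<in> A. a < x}"
    by (metis card_image)
  have "g x \<in> A" using gA assms(4) by blast
  then show ?thesis
    using card_below_less[OF assms(1), of x "g x"] card_below_less[OF assms(1), of "g x" x]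
      assms(4) eq by (cases "g x" x rule: linorder_cases) auto
qed

text \<open>Two decreasing bijections in opposite directions compose to an increasing bijection of
  \<open>A\<close> onto itself, which is the identity.\<close>

lemma reversal_reversal:
  assumes "finite A" "finite B" "card A = card B" "x \<in> A"
  shows "reversal B A (reversal A B x) = x"
proof -
  note AB = reversal_bij_antimono[OF assms(1-3)]
  note BA = reversal_bij_antimono[OF assms(2,1) assms(3)[symmetric]]
  have "bij_betw (reversal B A \<circ> reversal A B) A A"
    using AB(1) BA(1) by (rule bij_betw_trans)
  moreover have "monotone_on A (<) (<) (reversal B A \<circ> reversal A B)"
  proof (rule monotone_onI)
    fix u v assume uv: "u \<in> A" "v \<in> A" "u < v"
    have "reversal A B u \<in> B" "reversal A B v \<in> B"
      using AB(1) uv by (auto dest: bij_betw_apply)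
    moreover have "reversal A B v < reversal A B u"
      using monotone_onD[OF AB(2)] uv by blast
    ultimately show "(reversal B A \<circ> reversal A B) u < (reversal B A \<circ> reversal A B) v"
      using monotone_onD[OF BA(2)] by simp
  qed
  ultimately show ?thesis
    using strict_mono_bij_finite_eq[OF assms(1)] assms(4) by fastforce
qed

section \<open>Flipping the support of a Fishburn matrix\<close>

definition live :: "cell set \<Rightarrow> nat \<Rightarrow> nat set" where
  "live P j = {i. i \<le> j \<and> (\<exists>j'\<ge>j. (i, j') \<in> P)}"

text \<open>\<open>flip P j\<close> maps the rows live at \<open>j\<close> in \<open>P\<close> to those live at \<open>j\<close> in \<open>flip_cells P\<close>. It is
  meaningful only on \<open>live P j\<close> with \<open>j\<close> at most the size of the matrix.\<close>

fun flip :: "cell set \<Rightarrow> nat \<Rightarrow> nat \<Rightarrow> nat" where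
  "flip P 0 = (\<lambda>i. i)"
| "flip P (Suc j) = reversal (live P (Suc j))
     (insert (Suc j) (flip P j ` (live P (Suc j) - {Suc j})))"

definition flip_cells :: "cell set \<Rightarrow> cell set" where
  "flip_cells P = (\<lambda>(i, j). (flip P j i, j)) ` P"

text \<open>The possible supports of Fishburn matrices: upper triangular without zero rows or
  columns. The multiplicities of the entries are left out because being extremal depends on the
  support only.\<close>

definition fishburn_support :: "nat \<Rightarrow> cell set \<Rightarrow> bool" where
  "fishburn_support m P \<longleftrightarrow>
     (\<forall>(i, j)\<in>P. i \<le> j) \<and> fst ` P = {1..m} \<and> snd ` P = {1..m}"

lemma fishburn_supportD:
  assumes "fishburn_support m P" "(i, j) \<in> P"
  shows "1 \<le> i" "i \<le> j" "j \<le> m"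
proof -
  have "i \<in> fst ` P" "j \<in> snd ` P" using assms(2) by force+
  then show "1 \<le> i" "i \<le> j" "j \<le> m"
    using assms by (auto simp: fishburn_support_def)
qed

lemma finite_live [simp]: "finite (live P j)"
  by (rule finite_subset[of _ "{..j}"]) (auto simp: live_def)

lemma live_Suc_subset: "live P (Suc j) - {Suc j} \<subseteq> live P j"
  unfolding live_def using Suc_leD le_Suc_eq by blast

text \<open>A row live at \<open>j\<close> has an entry in column \<open>j\<close> itself or further
  to the right. The row \<open>Suc j\<close> is taken away because it is born only in the next
  column.\<close>

lemma live_step:
  assumes "\<And>i j. (i, j) \<in> P \<Longrightarrow> i \<le> j"
  shows "live P j = {i. (i, j) \<in> P} \<union> (live P (Suc j) - {Suc j})"
proof (intro equalityI subsetI)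
  fix i assume "i \<in> live P j"
  then obtain j' where j': "i \<le> j" "j \<le> j'" "(i, j') \<in> P" by (auto simp: live_def)
  show "i \<in> {i. (i, j) \<in> P} \<union> (live P (Suc j) - {Suc j})"
  proof (cases "j' = j")
    case False
    with j' have "Suc j \<le> j'" by simp
    with j' show ?thesis by (auto simp: live_def)
  qed (use j' in simp)
next
  fix i assume "i \<in> {i. (i, j) \<in> P} \<union> (live P (Suc j) - {Suc j})"
  then show "i \<in> live P j" using live_Suc_subset[of P j] assms by (force simp: live_def)
qed

lemma live_Int_Suc: "live P j \<inter> live P (Suc j) = {i. i \<le> j \<and> (\<exists>j'>j. (i, j') \<in> P)}"
  by (auto simp: live_def Suc_le_eq intro: less_imp_le)

lemma in_live_Suc: "i \<le> j \<Longrightarrow> i \<in> live P (Suc j) \<longleftrightarrow> (\<exists>j'>j. (i, j') \<in> P)"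
  by (auto simp: live_def Suc_le_eq)

context
  fixes m :: nat and P :: "cell set"
  assumes P: "fishburn_support m P"
begin

lemma live_0: "live P 0 = {}"
  using fishburn_supportD[OF P] by (fastforce simp: live_def)

lemma live_beyond: "m < j \<Longrightarrow> live P j = {}"
  using fishburn_supportD(3)[OF P] by (force simp: live_def)

lemma diagonal_live:
  assumes "1 \<le> j" "j \<le> m" shows "j \<in> live P j"
proof -
  have "j \<in> fst ` P" using P assms by (simp add: fishburn_support_def)
  then show ?thesis using fishburn_supportD(2)[OF P] by (force simp: live_def)
qed

lemma cell_live: "(i, j) \<in> P \<Longrightarrow> i \<in> live P j"
  using fishburn_supportD(2)[OF P] by (auto simp: live_def)

text \<open>The properties are proved together: for \<open>reversal\<close> to be a bijection at
  \<open>Suc j\<close>, its source and target must have equal size, and this rests on injectivity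
  and on the range of \<open>flip P j\<close>.\<close>

lemma flip_live:
  assumes "j \<le> m"
  shows "monotone_on (live P j) (<) (>) (flip P j) \<and> flip P j ` live P j \<subseteq> {1..j} \<and>
    inj_on (flip P j) (live P j) \<and>
    (0 < j \<longrightarrow> flip P j ` live P j = insert j (flip P (j - 1) ` (live P j - {j})))"
  using assms
proof (induction j)
  case 0
  then show ?case by (simp add: live_0 monotone_on_def)
next
  case (Suc j)
  let ?L = "live P (Suc j)"
  let ?B = "insert (Suc j) (flip P j ` (?L - {Suc j}))"
  have IH: "flip P j ` live P j \<subseteq> {1..j}" "inj_on (flip P j) (live P j)" using Suc by auto
  have sub: "flip P j ` (?L - {Suc j}) \<subseteq> {1..j}" using IH(1) live_Suc_subset by blast
  have "card (flip P j ` (?L - {Suc j})) = card (?L - {Suc j})"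
    by (intro card_image inj_on_subset[OF IH(2)] live_Suc_subset)
  moreover have "Suc j \<notin> flip P j ` (?L - {Suc j})" using sub by auto
  moreover have "Suc j \<in> ?L" using diagonal_live Suc.prems by simp
  \<comment> \<open>Both sets consist of the newborn row \<open>Suc j\<close> and of equally many
    older rows, the target being the image of the surviving rows under an injective map.\<close>
  ultimately have card: "card ?L = card ?B"
    by (simp add: card_Suc_Diff1 del: card_Diff_insert card_Diff_singleton)
  note rev = reversal_bij_antimono[OF finite_live _ card]
  have "finite ?B" by simp
  from rev[OF this] sub show ?case by (auto simp: bij_betw_def)
qed

lemma flip_antimono:
  assumes "j \<le> m" "i \<in> live P j" "i' \<in> live P j"
  shows "flip P j i < flip P j i' \<longleftrightarrow> i' < i"
proof -
  have "monotone_on (live P j) (<) (>) (flip P j)" using flip_live assms(1) by blast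
  then show ?thesis using assms(2,3) monotone_onD by (metis less_asym linorder_neqE_nat)
qed

text \<open>The maps \<open>flip P (Suc j)\<close> and \<open>flip P j\<close> differ on the
  surviving rows, and the former need not fix \<open>Suc j\<close>. Only the sets of older rows in
  the flipped matrix agree, so on the left the newborn row is removed after taking the
  image.\<close>

lemma flip_live_step:
  assumes "j < m"
  shows "flip P (Suc j) ` live P (Suc j) - {Suc j} = flip P j ` (live P (Suc j) - {Suc j})"
proof -
  have "flip P j ` live P j \<subseteq> {1..j}" using flip_live assms by simp
  then have "Suc j \<notin> flip P j ` (live P (Suc j) - {Suc j})" using live_Suc_subset by fastforce
  moreover have "flip P (Suc j) ` live P (Suc j) = insert (Suc j) (flip P j ` (live P (Suc j) - {Suc j}))"
    using flip_live[of "Suc j"] assms by (simp del: flip.simps)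
  ultimately show ?thesis by blast
qed

lemma flip_bounds:
  assumes "(i, j) \<in> P"
  shows "1 \<le> flip P j i" "flip P j i \<le> j"
proof -
  have "flip P j ` live P j \<subseteq> {1..j}"
    using flip_live fishburn_supportD(3)[OF P assms] by blast
  then have "flip P j i \<in> {1..j}" using cell_live[OF assms] by blast
  then show "1 \<le> flip P j i" "flip P j i \<le> j" by auto
qed

lemma flip_cells_triangular: "(i, j) \<in> flip_cells P \<Longrightarrow> i \<le> j"
  using flip_bounds(2) by (auto simp: flip_cells_def)

lemma flip_cells_column: "{i. (i, j) \<in> flip_cells P} = flip P j ` {i. (i, j) \<in> P}"
  by (force simp: flip_cells_def)

lemma live_flip_cells_beyond: "m < j \<Longrightarrow> live (flip_cells P) j = {}"
  using fishburn_supportD(3)[OF P] by (force simp: live_def flip_cells_def)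

text \<open>Being live at \<open>j\<close> refers to the columns from \<open>j\<close> on, so the
  induction runs downwards from \<open>m\<close>, beyond which both supports are empty. In each step
  \<open>live_step\<close> adds the entries of column \<open>j\<close> to the rows that are live one
  column later.\<close>

lemma live_flip_cells:
  assumes "j \<le> m"
  shows "live (flip_cells P) j = flip P j ` live P j"
  using assms
proof (induction j rule: inc_induct)
  case base
  show ?case
    using live_step[of "flip_cells P" m] live_step[of P m] flip_cells_triangular
      live_flip_cells_beyond[of "Suc m"] live_beyond[of "Suc m"] fishburn_supportD(2)[OF P]
    by (simp add: flip_cells_column)
next
  case (step j)
  have "live (flip_cells P) j = flip P j ` {i. (i, j) \<in> P} \<union> (live (flip_cells P) (Suc j) - {Suc j})"
    using live_step[of "flip_cells P" j] flip_cells_triangular by (simp add: flip_cells_column)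
  also have "\<dots> = flip P j ` {i. (i, j) \<in> P} \<union> flip P j ` (live P (Suc j) - {Suc j})"
    using step flip_live_step by (simp del: flip.simps)
  also have "\<dots> = flip P j ` live P j"
    using live_step[of P j] fishburn_supportD(2)[OF P] by (simp add: image_Un)
  finally show ?case .
qed

lemma fishburn_support_flip_cells: "fishburn_support m (flip_cells P)"
proof -
  have tri: "\<forall>(i, j)\<in>flip_cells P. i \<le> j" using flip_cells_triangular by auto
  have "snd ` flip_cells P = snd ` P" by (simp add: flip_cells_def image_image case_prod_unfold)
  then have cols: "snd ` flip_cells P = {1..m}" using P by (simp add: fishburn_support_def)
  have "fst ` flip_cells P = {1..m}"
  proof
    show "fst ` flip_cells P \<subseteq> {1..m}"
    proof (rule image_subsetI)
      fix c assume "c \<in> flip_cells P"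
      then obtain i j where c: "c = (flip P j i, j)" "(i, j) \<in> P" by (auto simp: flip_cells_def)
      then show "fst c \<in> {1..m}"
        using flip_bounds[OF c(2)] fishburn_supportD(3)[OF P c(2)] by simp
    qed
    show "{1..m} \<subseteq> fst ` flip_cells P"
    proof
      \<comment> \<open>Row \<open>j\<close> of the flipped support is nonempty because
        \<open>j\<close> was inserted into the target set of \<open>flip P j\<close>, and all rows
        in that set are live.\<close>
      fix j assume j: "j \<in> {1..m}"
      then have "j \<in> live (flip_cells P) j"
        using flip_live[of j] live_flip_cells[of j] by simp
      then obtain j' where "(j, j') \<in> flip_cells P" by (auto simp: live_def)
      then show "j \<in> fst ` flip_cells P" by (rule image_eqI[rotated]) simp
    qed
  qed
  with tri cols show ?thesis by (simp add: fishburn_support_def)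
qed

text \<open>By the induction hypothesis the second flip sends the surviving rows back to where they
  came from, so its target set in column \<open>Suc j\<close> is \<open>live P (Suc j)\<close>. The
  two flips there are reversals between the same two sets in opposite directions.\<close>

lemma flip_flip:
  assumes "j \<le> m" "i \<in> live P j"
  shows "flip (flip_cells P) j (flip P j i) = i"
  using assms
proof (induction j arbitrary: i)
  case 0
  then show ?case by (simp add: live_0)
next
  case (Suc j)
  let ?L = "live P (Suc j)" and ?L' = "flip P (Suc j) ` live P (Suc j)"
  have L': "?L' = insert (Suc j) (flip P j ` (?L - {Suc j}))"
    using flip_live[OF Suc.prems(1)] by (simp del: flip.simps)
  have "flip (flip_cells P) j ` (?L' - {Suc j}) = flip (flip_cells P) j ` flip P j ` (?L - {Suc j})"
    using flip_live_step Suc.prems(1) by simp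
  also have "\<dots> = ?L - {Suc j}"
  proof -
    have "flip (flip_cells P) j (flip P j i) = i" if "i \<in> ?L - {Suc j}" for i
      using Suc.IH Suc.prems(1) that live_Suc_subset[of P j] by auto
    then show ?thesis by (simp add: image_image)
  qed
  finally have "insert (Suc j) (flip (flip_cells P) j ` (?L' - {Suc j})) = ?L"
    using diagonal_live[of "Suc j"] Suc.prems(1) by auto
  then have "flip (flip_cells P) (Suc j) = reversal ?L' ?L"
    using live_flip_cells[OF Suc.prems(1)] by simp
  moreover have "flip P (Suc j) = reversal ?L ?L'" using L' by simp
  moreover have "card ?L = card ?L'"
    using flip_live[OF Suc.prems(1)] by (metis card_image)
  ultimately show ?case using reversal_reversal Suc.prems(2) by (metis finite_imageI finite_live)
qed

text \<open>For \<open>j = m\<close> no row survives on either side. For smaller \<open>j\<close>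
  the older rows live at \<open>Suc j\<close> in the flipped matrix are the images of the survivors
  under \<open>flip P j\<close>, and injectivity on the rows live at \<open>j\<close> lets
  membership be read in both directions.\<close>

lemma flip_mem_live_Suc:
  assumes "j \<le> m" "i \<in> live P j"
  shows "flip P j i \<in> live (flip_cells P) (Suc j) \<longleftrightarrow> i \<in> live P (Suc j)"
proof (cases "j = m")
  case True
  then show ?thesis using live_beyond live_flip_cells_beyond by simp
next
  case False
  have "flip P j ` live P j \<subseteq> {1..j}" using flip_live[OF assms(1)] by blast
  then have "flip P j i \<in> {1..j}" using assms(2) by blast
  then have le: "i \<le> j" "flip P j i \<le> j" using assms(2) by (auto simp: live_def)
  have "flip P j i \<in> live (flip_cells P) (Suc j) \<longleftrightarrow> flip P j i \<in> flip P j ` (live P (Suc j) - {Suc j})"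
    using flip_live_step[of j] live_flip_cells[of "Suc j"] False assms(1) le by auto
  also have "\<dots> \<longleftrightarrow> i \<in> live P (Suc j) - {Suc j}"
    using flip_live[OF assms(1)] assms(2) live_Suc_subset
    by (meson inj_on_image_mem_iff)
  finally show ?thesis using le by auto
qed

section \<open>Extremal cells described by live rows\<close>

lemma weakly_SW_extremal_iff:
  assumes "(i, j) \<in> P"
  shows "(\<exists>c\<in>P. weakly_SW (i, j) c) \<longleftrightarrow> (\<exists>i'\<in>live P j. i' < i) \<or> i \<in> live P (Suc j)"
proof
  have ij: "i \<le> j" using fishburn_supportD[OF P assms] by simp
  assume "\<exists>c\<in>P. weakly_SW (i, j) c"
  then obtain i' j' where c: "(i', j') \<in> P" "weakly_SW (i, j) (i', j')" by auto
  then consider "i' < i" "j \<le> j'" | "i' = i" "j < j'"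
    by (auto simp: weakly_SW_def South_def West_def strictly_SW_def)
  then show "(\<exists>i'\<in>live P j. i' < i) \<or> i \<in> live P (Suc j)"
  proof cases
    case 1
    then have "i' \<in> live P j" using c(1) ij by (auto simp: live_def)
    with 1 show ?thesis by blast
  next
    case 2
    then show ?thesis using c(1) in_live_Suc[OF ij] by blast
  qed
next
  have ij: "i \<le> j" using fishburn_supportD[OF P assms] by simp
  assume "(\<exists>i'\<in>live P j. i' < i) \<or> i \<in> live P (Suc j)"
  then obtain i' j' where "(i', j') \<in> P" "i' < i \<and> j \<le> j' \<or> i' = i \<and> j < j'"
    using in_live_Suc[OF ij, of P] by (auto simp: live_def)
  then show "\<exists>c\<in>P. weakly_SW (i, j) c"
    by (intro bexI[of _ "(i', j')"])
      (auto simp: weakly_SW_def South_def West_def strictly_SW_def)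
qed

text \<open>A nonzero cell in a lower row \<open>i'\<close> is incomparable to \<open>(i, j)\<close>
  exactly when \<open>i' \<le> j\<close>. This is the bound built into \<open>live P j\<close>, so
  the lower live rows account for the cells strictly to the north-west of which
  \<open>(i, j)\<close> lies and for those in its own column; the same row is accounted for by
  survival.\<close>

lemma weakly_NW_extremal_iff:
  assumes "(i, j) \<in> P"
  shows "(\<exists>c\<in>P. weakly_NW (i, j) c) \<longleftrightarrow> (\<exists>i'\<in>live P j. i < i') \<or> i \<in> live P (Suc j)"
proof
  have ij: "i \<le> j" using fishburn_supportD[OF P assms] by simp
  assume "\<exists>c\<in>P. weakly_NW (i, j) c"
  then obtain i' j' where c: "(i', j') \<in> P" "weakly_NW (i, j) (i', j')" by auto
  then consider "i < i'" "i' \<le> j" "j \<le> j'" | "i' = i" "j < j'"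
    using fishburn_supportD(2)[OF P c(1)]
    by (auto simp: weakly_NW_def North_def West_def strictly_NW_def cell_comparable_def
        cell_greater_def)
  then show "(\<exists>i'\<in>live P j. i < i') \<or> i \<in> live P (Suc j)"
  proof cases
    case 1
    then have "i' \<in> live P j" using c(1) by (auto simp: live_def)
    with 1 show ?thesis by blast
  next
    case 2
    then show ?thesis using c(1) in_live_Suc[OF ij] by blast
  qed
next
  have ij: "i \<le> j" using fishburn_supportD[OF P assms] by simp
  assume "(\<exists>i'\<in>live P j. i < i') \<or> i \<in> live P (Suc j)"
  then obtain i' j' where "(i', j') \<in> P" "i < i' \<and> i' \<le> j \<and> j \<le> j' \<or> i' = i \<and> j < j'"
    using in_live_Suc[OF ij, of P] by (auto simp: live_def)
  then show "\<exists>c\<in>P. weakly_NW (i, j) c"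
    using ij by (intro bexI[of _ "(i', j')"])
      (auto simp: weakly_NW_def North_def West_def strictly_NW_def cell_comparable_def
        cell_greater_def)
qed

text \<open>A strictly larger column index means that the row of the other cell survives column
  \<open>j\<close>. The bound \<open>i' \<le> j\<close> follows from \<open>i' < i\<close> and
  brings the condition into the form of \<open>live_Int_Suc\<close>.\<close>

lemma strictly_SW_extremal_iff:
  assumes "(i, j) \<in> P"
  shows "(\<exists>c\<in>P. strictly_SW (i, j) c) \<longleftrightarrow> (\<exists>i'\<in>live P j \<inter> live P (Suc j). i' < i)"
proof -
  have eq: "strictly_SW (i, j) (i', j') \<longleftrightarrow> i' \<le> j \<and> j < j' \<and> i' < i" for i' j'
    using fishburn_supportD(2)[OF P assms] by (auto simp: strictly_SW_def)
  show ?thesis unfolding live_Int_Suc Bex_def split_paired_Ex eq by blast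
qed

lemma strictly_NW_extremal_iff:
  assumes "(i, j) \<in> P"
  shows "(\<exists>c\<in>P. strictly_NW (i, j) c) \<longleftrightarrow> (\<exists>i'\<in>live P j \<inter> live P (Suc j). i < i')"
proof -
  \<comment> \<open>Here incomparability reduces to \<open>i' \<le> j\<close>, since
    \<open>j' < i\<close> is excluded by \<open>i \<le> j < j'\<close>.\<close>
  have eq: "strictly_NW (i, j) (i', j') \<longleftrightarrow> i' \<le> j \<and> j < j' \<and> i < i'" for i' j'
    using fishburn_supportD(2)[OF P assms]
    by (auto simp: strictly_NW_def cell_comparable_def cell_greater_def)
  show ?thesis unfolding live_Int_Suc Bex_def split_paired_Ex eq by blast
qed

end

lemma flip_cells_mem: "(i, j) \<in> P \<Longrightarrow> (flip P j i, j) \<in> flip_cells P"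
  by (force simp: flip_cells_def)

text \<open>The four criteria refer only to the order of the rows live at \<open>j\<close> and to
  which of them survive. The map \<open>flip P j\<close> reverses that order and respects survival,
  so north-west and south-west change places.\<close>

lemma flip_extremal:
  assumes P: "fishburn_support m P" and c: "(i, j) \<in> P"
  shows "(\<exists>d\<in>flip_cells P. weakly_NW (flip P j i, j) d) \<longleftrightarrow> (\<exists>d\<in>P. weakly_SW (i, j) d)"
    and "(\<exists>d\<in>flip_cells P. weakly_SW (flip P j i, j) d) \<longleftrightarrow> (\<exists>d\<in>P. weakly_NW (i, j) d)"
    and "(\<exists>d\<in>flip_cells P. strictly_NW (flip P j i, j) d) \<longleftrightarrow> (\<exists>d\<in>P. strictly_SW (i, j) d)"
    and "(\<exists>d\<in>flip_cells P. strictly_SW (flip P j i, j) d) \<longleftrightarrow> (\<exists>d\<in>P. strictly_NW (i, j) d)"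
proof -
  note P' = fishburn_support_flip_cells[OF P]
  note c' = flip_cells_mem[OF c]
  have j: "j \<le> m" using fishburn_supportD[OF P c] by simp
  have i: "i \<in> live P j" using cell_live[OF P c] .
  note live = live_flip_cells[OF P j]
  note less = flip_antimono[OF P j]
  note Suc = flip_mem_live_Suc[OF P j]
  show "(\<exists>d\<in>flip_cells P. weakly_NW (flip P j i, j) d) \<longleftrightarrow> (\<exists>d\<in>P. weakly_SW (i, j) d)"
    unfolding weakly_NW_extremal_iff[OF P' c'] weakly_SW_extremal_iff[OF P c] live
    using i less Suc by auto
  show "(\<exists>d\<in>flip_cells P. weakly_SW (flip P j i, j) d) \<longleftrightarrow> (\<exists>d\<in>P. weakly_NW (i, j) d)"
    unfolding weakly_SW_extremal_iff[OF P' c'] weakly_NW_extremal_iff[OF P c] live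
    using i less Suc by auto
  show "(\<exists>d\<in>flip_cells P. strictly_NW (flip P j i, j) d) \<longleftrightarrow> (\<exists>d\<in>P. strictly_SW (i, j) d)"
    unfolding strictly_NW_extremal_iff[OF P' c'] strictly_SW_extremal_iff[OF P c] live
    using i less Suc by auto
  show "(\<exists>d\<in>flip_cells P. strictly_SW (flip P j i, j) d) \<longleftrightarrow> (\<exists>d\<in>P. strictly_NW (i, j) d)"
    unfolding strictly_SW_extremal_iff[OF P' c'] strictly_NW_extremal_iff[OF P c] live
    using i less Suc by auto
qed

text \<open>Flipping the cells of \<open>P\<close> is injective, its inverse being the flip of
  \<open>flip_cells P\<close>; by \<open>ext\<close> it matches the cells extremal for
  \<open>Q\<close> with those extremal for \<open>Q'\<close>.\<close>

lemma card_extremal_flip_cells: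
  assumes P: "fishburn_support m P"
    and ext: "\<And>i j. (i, j) \<in> P \<Longrightarrow>
      (\<exists>d\<in>flip_cells P. Q' (flip P j i, j) d) \<longleftrightarrow> (\<exists>d\<in>P. Q (i, j) d)"
  shows "card {c \<in> flip_cells P. \<not> (\<exists>d\<in>flip_cells P. Q' c d)} = card {c \<in> P. \<not> (\<exists>d\<in>P. Q c d)}"
proof -
  let ?g = "\<lambda>(i, j). (flip P j i, j)"
  have "inj_on ?g P"
  proof (rule inj_on_inverseI)
    fix c assume "c \<in> P"
    moreover obtain i j where "c = (i, j)" by force
    ultimately show "(\<lambda>(i, j). (flip (flip_cells P) j i, j)) (?g c) = c"
      using flip_flip[OF P] cell_live[OF P] fishburn_supportD(3)[OF P] by simp
  qed
  then have "inj_on ?g {c \<in> P. \<not> (\<exists>d\<in>P. Q c d)}" by (rule inj_on_subset) auto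
  moreover have "{c \<in> flip_cells P. \<not> (\<exists>d\<in>flip_cells P. Q' c d)} = ?g ` {c \<in> P. \<not> (\<exists>d\<in>P. Q c d)}"
    (is "?L = ?R")
  proof (intro equalityI subsetI)
    fix c assume c: "c \<in> ?L"
    then obtain i j where ij: "(i, j) \<in> P" "c = (flip P j i, j)" by (auto simp: flip_cells_def)
    then have "(i, j) \<in> {c \<in> P. \<not> (\<exists>d\<in>P. Q c d)}" using c ext by auto
    then show "c \<in> ?R" by (rule image_eqI[rotated]) (use ij in simp)
  next
    fix c assume "c \<in> ?R"
    then obtain i j where "(i, j) \<in> P" "\<not> (\<exists>d\<in>P. Q (i, j) d)" "c = (flip P j i, j)" by auto
    then show "c \<in> ?L" using ext[of i j] flip_cells_mem[of i j P] by simp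
  qed
  ultimately show ?thesis by (simp add: card_image)
qed

section \<open>Maximal elements as extremal cells\<close>

lemma strict_linear_order_on_unique_max:
  assumes "finite X" "X \<noteq> {}" "strict_linear_order_on X r"
  shows "\<exists>!x. x \<in> X \<and> (\<forall>y\<in>X. (x, y) \<notin> r)"
proof -
  have tr: "trans r" and ir: "irrefl r" and tot: "total_on X r"
    using assms(3) by (auto simp: strict_linear_order_on_def)
  have "\<exists>x\<in>X. \<forall>y\<in>X. (x, y) \<notin> r"
    using assms(1,2)
  proof (induction rule: finite_ne_induct)
    case (singleton x)
    then show ?case using ir by (auto simp: irrefl_def)
  next
    case (insert x F)
    then obtain z where z: "z \<in> F" "\<forall>y\<in>F. (z, y) \<notin> r" by blast
    show ?case
    proof (cases "(z, x) \<in> r")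
      case True
      then show ?thesis using z tr ir by (metis insert_iff irrefl_def transD)
    qed (use z in blast)
  qed
  then show ?thesis using tot by (metis total_on_def)
qed

text \<open>A linear order inside a cell leaves exactly one candidate for a maximal element there,
  and this candidate is maximal in \<open>A\<close> iff the cell is extremal. Hence cells are
  counted.\<close>

lemma num_maximal_linear_cells:
  assumes "finite A"
    and S: "\<And>x y. x \<in> A \<Longrightarrow> y \<in> A \<Longrightarrow> c x \<noteq> c y \<Longrightarrow> (x, y) \<in> S \<longleftrightarrow> Q (c x) (c y)"
    and lin: "\<And>d. strict_linear_order_on {x \<in> A. c x = d} (Restr S {x \<in> A. c x = d})"
    and irr: "\<And>d. \<not> Q d d"
  shows "num_maximal A S = card {d \<in> c ` A. \<not> (\<exists>d'\<in>c ` A. Q d d')}"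
proof -
  have ex1: "\<exists>!x. x \<in> A \<and> c x = d \<and> (\<forall>y\<in>A. c y = d \<longrightarrow> (x, y) \<notin> S)" if "d \<in> c ` A" for d
  proof -
    have "\<exists>!x. x \<in> {x \<in> A. c x = d} \<and> (\<forall>y\<in>{x \<in> A. c x = d}. (x, y) \<notin> Restr S {x \<in> A. c x = d})"
      using assms(1) that lin by (intro strict_linear_order_on_unique_max) auto
    moreover have "x \<in> {x \<in> A. c x = d} \<and>
        (\<forall>y\<in>{x \<in> A. c x = d}. (x, y) \<notin> Restr S {x \<in> A. c x = d}) \<longleftrightarrow>
        x \<in> A \<and> c x = d \<and> (\<forall>y\<in>A. c y = d \<longrightarrow> (x, y) \<notin> S)" for x
      by auto
    ultimately show ?thesis by simp
  qed
  have max_iff: "(\<forall>y\<in>A. (x, y) \<notin> S) \<longleftrightarrow>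
      (\<forall>y\<in>A. c y = c x \<longrightarrow> (x, y) \<notin> S) \<and> \<not> (\<exists>d'\<in>c ` A. Q (c x) d')" if "x \<in> A" for x
  proof -
    have "(x, y) \<in> S \<longleftrightarrow> c y = c x \<and> (x, y) \<in> S \<or> Q (c x) (c y)" if "y \<in> A" for y
      using S[OF \<open>x \<in> A\<close> that] irr by (cases "c x = c y") auto
    then show ?thesis by blast
  qed
  have "bij_betw c {x \<in> A. \<not> (\<exists>y\<in>A. (x, y) \<in> S)} {d \<in> c ` A. \<not> (\<exists>d'\<in>c ` A. Q d d')}"
    unfolding bij_betw_def
  proof (intro conjI inj_onI equalityI subsetI)
    fix x y assume xy: "x \<in> {x \<in> A. \<not> (\<exists>y\<in>A. (x, y) \<in> S)}" "y \<in> {x \<in> A. \<not> (\<exists>y\<in>A. (x, y) \<in> S)}"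
      and "c x = c y"
    moreover have "c x \<in> c ` A" using xy by blast
    ultimately show "x = y" using ex1[of "c x"] by auto
  next
    fix d assume "d \<in> c ` {x \<in> A. \<not> (\<exists>y\<in>A. (x, y) \<in> S)}"
    then show "d \<in> {d \<in> c ` A. \<not> (\<exists>d'\<in>c ` A. Q d d')}" using max_iff by blast
  next
    fix d assume d: "d \<in> {d \<in> c ` A. \<not> (\<exists>d'\<in>c ` A. Q d d')}"
    then obtain x where "x \<in> A" "c x = d" "\<forall>y\<in>A. c y = d \<longrightarrow> (x, y) \<notin> S" using ex1 by blast
    then show "d \<in> c ` {x \<in> A. \<not> (\<exists>y\<in>A. (x, y) \<in> S)}" using max_iff[of x] d by blast
  qed
  then show ?thesis unfolding num_maximal_def by (rule bij_betw_same_card)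
qed

text \<open>Without pairs inside the cells, all elements of an extremal cell are maximal, so here
  elements are counted and multiplicities matter.\<close>

lemma num_maximal_empty_cells:
  assumes S: "\<And>x y. x \<in> A \<Longrightarrow> y \<in> A \<Longrightarrow> c x \<noteq> c y \<Longrightarrow> (x, y) \<in> S \<longleftrightarrow> Q (c x) (c y)"
    and emp: "\<And>d. Restr S {x \<in> A. c x = d} = {}"
    and irr: "\<And>d. \<not> Q d d"
  shows "num_maximal A S = card {x \<in> A. \<not> (\<exists>d\<in>c ` A. Q (c x) d)}"
proof -
  have "(x, y) \<in> S \<longleftrightarrow> Q (c x) (c y)" if "x \<in> A" "y \<in> A" for x y
  proof (cases "c x = c y")
    case True
    then have "(x, y) \<notin> S" using emp[of "c x"] that by auto
    then show ?thesis using True irr by simp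
  qed (use S that in simp)
  then show ?thesis unfolding num_maximal_def by (intro arg_cong[of _ _ card]) auto
qed

definition cells :: "'a set \<Rightarrow> ('a \<Rightarrow> nat) \<Rightarrow> ('a \<Rightarrow> nat) \<Rightarrow> cell set" where
  "cells A l r = (\<lambda>x. (l x, r x)) ` A"

definition num_extremal_cells :: "cell set \<Rightarrow> (cell \<Rightarrow> cell \<Rightarrow> bool) \<Rightarrow> nat" where
  "num_extremal_cells P Q = card {c \<in> P. \<not> (\<exists>d\<in>P. Q c d)}"

definition num_extremal_elems ::
    "'a set \<Rightarrow> ('a \<Rightarrow> nat) \<Rightarrow> ('a \<Rightarrow> nat) \<Rightarrow> (cell \<Rightarrow> cell \<Rightarrow> bool) \<Rightarrow> nat" where
  "num_extremal_elems A l r Q = card {x \<in> A. \<not> (\<exists>d\<in>cells A l r. Q (l x, r x) d)}"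

lemma cells_cong:
  "(\<And>x. x \<in> A \<Longrightarrow> l x = l' x \<and> r x = r' x) \<Longrightarrow> cells A l r = cells A l' r'"
  by (auto simp: cells_def)

lemma num_extremal_elems_cong:
  assumes "\<And>x. x \<in> A \<Longrightarrow> l x = l' x \<and> r x = r' x"
  shows "num_extremal_elems A l r Q = num_extremal_elems A l' r' Q"
  using cells_cong[of A l l' r r', OF assms] assms unfolding num_extremal_elems_def
  by (intro arg_cong[of _ _ card]) auto

lemma cells_comp: "f ` A = A \<Longrightarrow> cells A (l \<circ> f) (r \<circ> f) = cells A l r"
  using image_image[of "\<lambda>x. (l x, r x)" f A] by (simp add: cells_def)

lemma card_Collect_comp_bij:
  assumes "bij_betw f A A"
  shows "card {x \<in> A. p (f x)} = card {x \<in> A. p x}"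
proof (rule bij_betw_same_card)
  have "f ` A = A" using assms by (simp add: bij_betw_def)
  then have "f ` {x \<in> A. p (f x)} = {x \<in> f ` A. p x}" by auto
  with \<open>f ` A = A\<close> have "f ` {x \<in> A. p (f x)} = {x \<in> A. p x}" by simp
  then show "bij_betw f {x \<in> A. p (f x)} {x \<in> A. p x}"
    by (rule bij_betw_subset[OF assms, rotated]) blast
qed

lemma num_extremal_elems_comp:
  assumes "bij_betw f A A"
  shows "num_extremal_elems A (l \<circ> f) (r \<circ> f) Q = num_extremal_elems A l r Q"
proof -
  have fA: "f ` A = A" using assms by (simp add: bij_betw_def)
  show ?thesis
    unfolding num_extremal_elems_def cells_comp[OF fA] comp_apply
    by (rule card_Collect_comp_bij[OF assms, of "\<lambda>x. \<not> (\<exists>d\<in>cells A l r. Q (l x, r x) d)"])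
qed

lemma cell_relations_irrefl:
  "\<not> weakly_SW d d" "\<not> weakly_NW d d" "\<not> strictly_SW d d" "\<not> strictly_NW d d"
  by (auto simp: weakly_SW_def weakly_NW_def strictly_SW_def strictly_NW_def South_def
      North_def West_def)

lemma F1_triple_num_maximal:
  assumes "finite A" and rep: "minimal_interval_rep A R m l r" and F1: "F1_triple A T S R"
  shows "num_maximal A S = num_extremal_cells (cells A l r) weakly_SW"
    and "num_maximal A T = num_extremal_elems A l r strictly_NW"
proof -
  obtain m' l' r' where rep': "minimal_interval_rep A R m' l' r'"
    and off: "\<forall>x\<in>A. \<forall>y\<in>A. (l' x, r' x) \<noteq> (l' y, r' y) \<longrightarrow>
           ((x, y) \<in> T \<longleftrightarrow> strictly_NW (l' x, r' x) (l' y, r' y)) \<and>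
           ((x, y) \<in> S \<longleftrightarrow> weakly_SW (l' x, r' x) (l' y, r' y))"
    and on: "\<forall>c. strict_linear_order_on (elems_of_cell A l' r' c) (Restr S (elems_of_cell A l' r' c)) \<and>
             Restr T (elems_of_cell A l' r' c) = {}"
    using F1 unfolding F1_triple_def by blast
  \<comment> \<open>The representation hidden in the triple agrees with the given one on
    \<open>A\<close> by uniqueness. The functions may differ outside \<open>A\<close>, so the counts
    are transferred by congruence.\<close>
  have eq: "l' x = l x \<and> r' x = r x" if "x \<in> A" for x
    using minimal_interval_rep_unique[OF rep' rep] that by blast
  have "num_maximal A S = num_extremal_cells (cells A l' r') weakly_SW"
    unfolding num_extremal_cells_def cells_def
    by (rule num_maximal_linear_cells)
      (use assms(1) off on cell_relations_irrefl in \<open>simp_all add: elems_of_cell_def del: split_paired_All prod.inject\<close>)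
  then show "num_maximal A S = num_extremal_cells (cells A l r) weakly_SW"
    using cells_cong eq by metis
  have "num_maximal A T = num_extremal_elems A l' r' strictly_NW"
    unfolding num_extremal_elems_def cells_def
    by (rule num_maximal_empty_cells)
      (use off on cell_relations_irrefl in \<open>simp_all add: elems_of_cell_def del: split_paired_All prod.inject\<close>)
  then show "num_maximal A T = num_extremal_elems A l r strictly_NW"
    using num_extremal_elems_cong eq by metis
qed

lemma F2_triple_num_maximal:
  assumes "finite A" and rep: "minimal_interval_rep A R m l r" and F2: "F2_triple A T S R"
  shows "num_maximal A T = num_extremal_cells (cells A l r) weakly_NW"
    and "num_maximal A S = num_extremal_elems A l r strictly_SW"
proof -
  obtain m' l' r' where rep': "minimal_interval_rep A R m' l' r'"
    and off: "\<forall>x\<in>A. \<forall>y\<in>A. (l' x, r' x) \<noteq> (l' y, r' y) \<longrightarrow>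
           ((x, y) \<in> T \<longleftrightarrow> weakly_NW (l' x, r' x) (l' y, r' y)) \<and>
           ((x, y) \<in> S \<longleftrightarrow> strictly_SW (l' x, r' x) (l' y, r' y))"
    and on: "\<forall>c. strict_linear_order_on (elems_of_cell A l' r' c) (Restr T (elems_of_cell A l' r' c)) \<and>
             Restr S (elems_of_cell A l' r' c) = {}"
    using F2 unfolding F2_triple_def by blast
  have eq: "l' x = l x \<and> r' x = r x" if "x \<in> A" for x
    using minimal_interval_rep_unique[OF rep' rep] that by blast
  have "num_maximal A T = num_extremal_cells (cells A l' r') weakly_NW"
    unfolding num_extremal_cells_def cells_def
    by (rule num_maximal_linear_cells)
      (use assms(1) off on cell_relations_irrefl in \<open>simp_all add: elems_of_cell_def del: split_paired_All prod.inject\<close>)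
  then show "num_maximal A T = num_extremal_cells (cells A l r) weakly_NW"
    using cells_cong eq by metis
  have "num_maximal A S = num_extremal_elems A l' r' strictly_SW"
    unfolding num_extremal_elems_def cells_def
    by (rule num_maximal_empty_cells)
      (use off on cell_relations_irrefl in \<open>simp_all add: elems_of_cell_def del: split_paired_All prod.inject\<close>)
  then show "num_maximal A S = num_extremal_elems A l r strictly_SW"
    using num_extremal_elems_cong eq by metis
qed

text \<open>Since \<open>m\<close> is itself a left endpoint, every element ending before
  \<open>m\<close> lies below some element. The maximal elements are those of the last
  column.\<close>

lemma num_maximal_rep:
  assumes "minimal_interval_rep A R m l r"
  shows "num_maximal A R = card {x \<in> A. r x = m}"
proof -
  have "(\<exists>y\<in>A. (x, y) \<in> R) \<longleftrightarrow> r x \<noteq> m" if "x \<in> A" for x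
  proof -
    have xm: "r x \<in> {1..m}" and img: "l ` A = {1..m}"
      using assms that unfolding minimal_interval_rep_def by blast+
    have iff: "\<And>y. y \<in> A \<Longrightarrow> (x, y) \<in> R \<longleftrightarrow> r x < l y"
      using assms that unfolding minimal_interval_rep_def by blast
    have le: "l y \<le> m" if "y \<in> A" for y using img that by fastforce
    have "m \<in> l ` A" using img xm by simp
    then obtain y where y: "y \<in> A" "l y = m" by blast
    then show ?thesis using iff le xm by fastforce
  qed
  then show ?thesis unfolding num_maximal_def by (intro arg_cong[of _ _ card]) auto
qed

section \<open>The involution on interval orders\<close>

text \<open>Only left endpoints move; right endpoints are kept. Elements of one cell move together,
  so the multiplicities travel with the cells.\<close>

definition flip_left :: "'a set \<Rightarrow> ('a \<Rightarrow> nat) \<Rightarrow> ('a \<Rightarrow> nat) \<Rightarrow> 'a \<Rightarrow> nat" where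
  "flip_left A l r x = flip (cells A l r) (r x) (l x)"

definition rep_of :: "'a set \<Rightarrow> 'a rel \<Rightarrow> ('a \<Rightarrow> nat) \<times> ('a \<Rightarrow> nat)" where
  "rep_of A R = (SOME (l, r). \<exists>m. minimal_interval_rep A R m l r)"

definition flip_order :: "'a set \<Rightarrow> 'a rel \<Rightarrow> 'a rel" where
  "flip_order A R = (case rep_of A R of (l, r) \<Rightarrow>
     {(x, y). x \<in> A \<and> y \<in> A \<and> r x < flip_left A l r y})"

lemma fishburn_support_cells:
  "minimal_interval_rep A R m l r \<Longrightarrow> fishburn_support m (cells A l r)"
  by (auto simp: minimal_interval_rep_def fishburn_support_def cells_def image_image)

lemma cells_flip_left: "cells A (flip_left A l r) r = flip_cells (cells A l r)"
  unfolding flip_cells_def by (simp add: cells_def[of A] image_image flip_left_def)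

lemma flip_left_flip_left:
  assumes "minimal_interval_rep A R m l r" "x \<in> A"
  shows "flip_left A (flip_left A l r) r x = l x"
proof -
  have P: "fishburn_support m (cells A l r)" using fishburn_support_cells[OF assms(1)] .
  have "(l x, r x) \<in> cells A l r" using assms(2) by (simp add: cells_def)
  then show ?thesis
    using flip_flip[OF P fishburn_supportD(3)[OF P] cell_live[OF P]]
    unfolding flip_left_def[of A "flip_left A l r"] cells_flip_left
    by (simp add: flip_left_def)
qed

text \<open>The choice made in \<open>rep_of\<close> does not influence the result: minimal
  representations agree on \<open>A\<close>, and the formula evaluates the endpoints on
  \<open>A\<close> only.\<close>

lemma flip_order_eq:
  assumes "minimal_interval_rep A R m l r"
  shows "flip_order A R = {(x, y). x \<in> A \<and> y \<in> A \<and> r x < flip_left A l r y}"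
proof -
  obtain l' r' where lr: "rep_of A R = (l', r')" by fastforce
  have "\<exists>m. case rep_of A R of (l, r) \<Rightarrow> minimal_interval_rep A R m l r"
    unfolding rep_of_def by (rule someI2[where a = "(l, r)"]) (use assms in auto)
  then obtain m' where "minimal_interval_rep A R m' l' r'" using lr by auto
  then have eq: "l' x = l x \<and> r' x = r x" if "x \<in> A" for x
    using minimal_interval_rep_unique[OF _ assms] that by blast
  then have "cells A l' r' = cells A l r" by (rule cells_cong)
  then show ?thesis using eq by (auto simp: flip_order_def lr flip_left_def)
qed

text \<open>The flipped support is again a Fishburn support of size \<open>m\<close>, which gives
  \<open>l \<le> r\<close> and the two endpoint sets; the order condition holds by the definition of
  \<open>flip_order\<close>.\<close>

lemma minimal_interval_rep_flip:
  assumes rep: "minimal_interval_rep A R m l r"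
  shows "minimal_interval_rep A (flip_order A R) m (flip_left A l r) r"
proof -
  have P': "fishburn_support m (cells A (flip_left A l r) r)"
    unfolding cells_flip_left using fishburn_support_flip_cells fishburn_support_cells[OF rep] .
  then show ?thesis
    unfolding minimal_interval_rep_def flip_order_eq[OF rep]
    by (auto simp: fishburn_support_def cells_def image_image)
qed

lemma flip_order_subset:
  "minimal_interval_rep A R m l r \<Longrightarrow> flip_order A R \<subseteq> A \<times> A"
  by (auto simp: flip_order_eq)

text \<open>The second flip is computed from the explicit representation of the first. As a
  representation determines \<open>R\<close> only on pairs from \<open>A\<close>, the inclusion
  \<open>R \<subseteq> A \<times> A\<close> settles the remaining pairs.\<close>

lemma flip_order_flip_order:
  assumes rep: "minimal_interval_rep A R m l r" and "R \<subseteq> A \<times> A"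
  shows "flip_order A (flip_order A R) = R"
proof -
  have "(x, y) \<in> R \<longleftrightarrow> x \<in> A \<and> y \<in> A \<and> r x < flip_left A (flip_left A l r) r y" for x y
  proof (cases "x \<in> A \<and> y \<in> A")
    case True
    then show ?thesis
      using rep flip_left_flip_left[OF rep] unfolding minimal_interval_rep_def by simp
  qed (use assms(2) in auto)
  then show ?thesis unfolding flip_order_eq[OF minimal_interval_rep_flip[OF rep]] by auto
qed

lemma interval_order_on_rep:
  assumes rep: "minimal_interval_rep A R m l r" and sub: "R \<subseteq> A \<times> A"
  shows "interval_order_on A R"
proof -
  have iff: "(x, y) \<in> R \<longleftrightarrow> x \<in> A \<and> y \<in> A \<and> r x < l y" for x y
  proof (cases "x \<in> A \<and> y \<in> A")
    case True
    then show ?thesis using rep unfolding minimal_interval_rep_def by simp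
  qed (use sub in auto)
  have le: "l x \<le> r x" if "x \<in> A" for x
    using that rep unfolding minimal_interval_rep_def by blast
  have "irrefl R"
  proof (rule irreflI)
    show "(x, x) \<notin> R" for x using iff[of x x] le[of x] by auto
  qed
  moreover have "trans R"
  proof (rule transI)
    fix x y z assume "(x, y) \<in> R" "(y, z) \<in> R"
    then show "(x, z) \<in> R" using iff le[of y] by auto
  qed
  moreover have "\<not> (\<exists>a\<in>A. \<exists>b\<in>A. \<exists>c\<in>A. \<exists>d\<in>A. distinct [a, b, c, d] \<and>
      Restr R {a, b, c, d} = {(a, b), (c, d)})"
  proof
    assume "\<exists>a\<in>A. \<exists>b\<in>A. \<exists>c\<in>A. \<exists>d\<in>A. distinct [a, b, c, d] \<and>
      Restr R {a, b, c, d} = {(a, b), (c, d)}"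
    then obtain a b c d where abcd: "a \<in> A" "b \<in> A" "c \<in> A" "d \<in> A" "distinct [a, b, c, d]"
      "Restr R {a, b, c, d} = {(a, b), (c, d)}" by blast
    have "(a, b) \<in> R" "(c, d) \<in> R" using abcd(6) by blast+
    moreover have "(a, d) \<notin> Restr R {a, b, c, d}" "(c, b) \<notin> Restr R {a, b, c, d}"
      unfolding abcd(6) using abcd(5) by auto
    then have "(a, d) \<notin> R" "(c, b) \<notin> R" by auto
    \<comment> \<open>The four comparisons give the cycle
      \<open>r a < l b \<le> r c < l d \<le> r a\<close>.\<close>
    ultimately show False
      using iff[of a b] iff[of c d] iff[of a d] iff[of c b] abcd(1-4) by simp
  qed
  ultimately show ?thesis using sub by (simp add: interval_order_on_def)
qed

lemma num_extremal_flip: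
  assumes rep: "minimal_interval_rep A R m l r"
  shows "num_extremal_cells (cells A (flip_left A l r) r) weakly_NW =
      num_extremal_cells (cells A l r) weakly_SW"
    and "num_extremal_cells (cells A (flip_left A l r) r) weakly_SW =
      num_extremal_cells (cells A l r) weakly_NW"
    and "num_extremal_elems A (flip_left A l r) r strictly_NW =
      num_extremal_elems A l r strictly_SW"
    and "num_extremal_elems A (flip_left A l r) r strictly_SW =
      num_extremal_elems A l r strictly_NW"
proof -
  note P = fishburn_support_cells[OF rep]
  show "num_extremal_cells (cells A (flip_left A l r) r) weakly_NW =
      num_extremal_cells (cells A l r) weakly_SW"
    "num_extremal_cells (cells A (flip_left A l r) r) weakly_SW =
      num_extremal_cells (cells A l r) weakly_NW"
    unfolding num_extremal_cells_def cells_flip_left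
    using card_extremal_flip_cells[OF P] flip_extremal[OF P] by blast+
  have mem: "(l x, r x) \<in> cells A l r" if "x \<in> A" for x
    using that by (simp add: cells_def)
  show "num_extremal_elems A (flip_left A l r) r strictly_NW =
      num_extremal_elems A l r strictly_SW"
    "num_extremal_elems A (flip_left A l r) r strictly_SW =
      num_extremal_elems A l r strictly_NW"
    unfolding num_extremal_elems_def cells_flip_left flip_left_def
    by (intro arg_cong[where f = card] Collect_cong conj_cong refl arg_cong[where f = Not],
        use flip_extremal(3,4)[OF P mem] in blast)+
qed

section \<open>Compatibility with isomorphisms\<close>

lemma minimal_interval_rep_comp:
  assumes "minimal_interval_rep A R' m l r" "bij_betw f A A"
    and "\<And>x y. x \<in> A \<Longrightarrow> y \<in> A \<Longrightarrow> (x, y) \<in> R \<longleftrightarrow> (f x, f y) \<in> R'"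
  shows "minimal_interval_rep A R m (l \<circ> f) (r \<circ> f)"
proof -
  have fA: "f ` A = A" using assms(2) by (simp add: bij_betw_def)
  then have "(l \<circ> f) ` A = l ` A" "(r \<circ> f) ` A = r ` A" by (metis image_comp)+
  moreover have "f x \<in> A" if "x \<in> A" for x using fA that by blast
  ultimately show ?thesis using assms(1,3) unfolding minimal_interval_rep_def by simp
qed

lemma iso_relE:
  assumes "(R, R') \<in> iso_rel n"
  obtains f where "interval_order_on {..<n} R" "interval_order_on {..<n} R'"
    "bij_betw f {..<n} {..<n}"
    "\<And>x y. x \<in> {..<n} \<Longrightarrow> y \<in> {..<n} \<Longrightarrow> (x, y) \<in> R \<longleftrightarrow> (f x, f y) \<in> R'"
  using assms unfolding iso_rel_def by auto

lemma equiv_iso_rel: "equiv {R. interval_order_on {..<n} R} (iso_rel n)"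
proof (rule equivI)
  show "iso_rel n \<subseteq> {R. interval_order_on {..<n} R} \<times> {R. interval_order_on {..<n} R}"
    by (auto simp: iso_rel_def)
  show "refl_on {R. interval_order_on {..<n} R} (iso_rel n)"
    by (auto simp: refl_on_def iso_rel_def intro!: exI[of _ id])
  show "sym (iso_rel n)"
  proof (rule symI)
    fix R R' assume "(R, R') \<in> iso_rel n"
    then obtain f where f: "interval_order_on {..<n} R" "interval_order_on {..<n} R'"
      "bij_betw f {..<n} {..<n}"
      "\<And>x y. x \<in> {..<n} \<Longrightarrow> y \<in> {..<n} \<Longrightarrow> (x, y) \<in> R \<longleftrightarrow> (f x, f y) \<in> R'"
      by (rule iso_relE) blast
    let ?g = "inv_into {..<n} f"
    have g: "bij_betw ?g {..<n} {..<n}" using f(3) by (rule bij_betw_inv_into)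
    have "(x, y) \<in> R' \<longleftrightarrow> (?g x, ?g y) \<in> R" if "x < n" "y < n" for x y
    proof -
      have "?g x \<in> {..<n}" "?g y \<in> {..<n}" using bij_betw_apply[OF g] that by simp_all
      then show ?thesis using f(4)[of "?g x" "?g y"] bij_betw_inv_into_right[OF f(3)] that by simp
    qed
    then show "(R', R) \<in> iso_rel n" using f(1,2) g unfolding iso_rel_def by blast
  qed
  show "trans (iso_rel n)"
  proof (rule transI)
    fix R R' R'' assume "(R, R') \<in> iso_rel n" "(R', R'') \<in> iso_rel n"
    then obtain f g where f: "interval_order_on {..<n} R" "bij_betw f {..<n} {..<n}"
      "\<And>x y. x \<in> {..<n} \<Longrightarrow> y \<in> {..<n} \<Longrightarrow> (x, y) \<in> R \<longleftrightarrow> (f x, f y) \<in> R'"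
      and g: "interval_order_on {..<n} R''" "bij_betw g {..<n} {..<n}"
      "\<And>x y. x \<in> {..<n} \<Longrightarrow> y \<in> {..<n} \<Longrightarrow> (x, y) \<in> R' \<longleftrightarrow> (g x, g y) \<in> R''"
      by (elim iso_relE) blast
    have "bij_betw (g \<circ> f) {..<n} {..<n}" using f(2) g(2) by (rule bij_betw_trans)
    moreover have "(x, y) \<in> R \<longleftrightarrow> ((g \<circ> f) x, (g \<circ> f) y) \<in> R''" if "x < n" "y < n" for x y
      using f(3) g(3) bij_betw_apply[OF f(2)] that by simp
    ultimately show "(R, R'') \<in> iso_rel n" using f(1) g(1) unfolding iso_rel_def by blast
  qed
qed

text \<open>A representation of \<open>R'\<close> pulled back along the isomorphism represents
  \<open>R\<close>. Both have the same set of cells, so the same row maps are used and the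
  isomorphism carries over to the flipped orders.\<close>

lemma flip_order_iso:
  assumes "(R, R') \<in> iso_rel n"
  shows "(flip_order {..<n} R, flip_order {..<n} R') \<in> iso_rel n"
proof -
  let ?A = "{..<n}"
  obtain f where f: "interval_order_on ?A R'" "bij_betw f ?A ?A"
    "\<And>x y. x \<in> ?A \<Longrightarrow> y \<in> ?A \<Longrightarrow> (x, y) \<in> R \<longleftrightarrow> (f x, f y) \<in> R'"
    using assms by (rule iso_relE) blast
  obtain m l r where rep': "minimal_interval_rep ?A R' m l r"
    using minimal_interval_rep_exists[OF _ f(1)] by blast
  have rep: "minimal_interval_rep ?A R m (l \<circ> f) (r \<circ> f)"
    using rep' f(2,3) by (rule minimal_interval_rep_comp)
  have "cells ?A (l \<circ> f) (r \<circ> f) = cells ?A l r"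
    using f(2) by (intro cells_comp) (simp add: bij_betw_def)
  then have "(x, y) \<in> flip_order ?A R \<longleftrightarrow> (f x, f y) \<in> flip_order ?A R'"
    if "x < n" "y < n" for x y
    unfolding flip_order_eq[OF rep] flip_order_eq[OF rep']
    using that bij_betw_apply[OF f(2)] by (simp add: flip_left_def)
  moreover have "interval_order_on ?A (flip_order ?A R)" "interval_order_on ?A (flip_order ?A R')"
    using interval_order_on_rep[OF minimal_interval_rep_flip flip_order_subset] rep rep' by blast+
  ultimately show ?thesis using f(2) unfolding iso_rel_def by blast
qed

text \<open>The order \<open>R'\<close> is only required to be isomorphic to the flipped order
  because the result is applied to arbitrary representatives of the image class.\<close>

lemma num_maximal_flip_order:
  assumes R: "interval_order_on {..<n} R" and iso: "(R', flip_order {..<n} R) \<in> iso_rel n"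
    and F: "F1_triple {..<n} T1 S1 R" "F2_triple {..<n} T2 S2 R"
      "F1_triple {..<n} T1' S1' R'" "F2_triple {..<n} T2' S2' R'"
  shows "num_maximal {..<n} S1 = num_maximal {..<n} T2' \<and>
    num_maximal {..<n} T2 = num_maximal {..<n} S1' \<and>
    num_maximal {..<n} S2 = num_maximal {..<n} T1' \<and>
    num_maximal {..<n} T1 = num_maximal {..<n} S2' \<and>
    num_maximal {..<n} R = num_maximal {..<n} R'"
proof -
  let ?A = "{..<n}"
  obtain m l r where rep: "minimal_interval_rep ?A R m l r"
    using minimal_interval_rep_exists[OF _ R] by blast
  obtain f where f: "bij_betw f ?A ?A"
    "\<And>x y. x \<in> ?A \<Longrightarrow> y \<in> ?A \<Longrightarrow> (x, y) \<in> R' \<longleftrightarrow> (f x, f y) \<in> flip_order ?A R"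
    using iso by (rule iso_relE) blast
  have fA: "f ` ?A = ?A" using f(1) by (simp add: bij_betw_def)
  have rep': "minimal_interval_rep ?A R' m (flip_left ?A l r \<circ> f) (r \<circ> f)"
    using minimal_interval_rep_flip[OF rep] f by (rule minimal_interval_rep_comp)
  \<comment> \<open>Right endpoints change only by the relabelling \<open>f\<close>, so the last
    column keeps its number of elements.\<close>
  have "card {x \<in> ?A. (r \<circ> f) x = m} = card {x \<in> ?A. r x = m}"
    unfolding comp_apply using card_Collect_comp_bij[OF f(1), of "\<lambda>x. r x = m"] .
  then show ?thesis
    unfolding F1_triple_num_maximal[OF finite_lessThan rep F(1)]
      F2_triple_num_maximal[OF finite_lessThan rep F(2)]
      F1_triple_num_maximal[OF finite_lessThan rep' F(3)]
      F2_triple_num_maximal[OF finite_lessThan rep' F(4)]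
      cells_comp[OF fA] num_extremal_elems_comp[OF f(1)] num_extremal_flip[OF rep]
      num_maximal_rep[OF rep] num_maximal_rep[OF rep']
    by simp
qed

section \<open>The involution and the statistics on isomorphism classes\<close>

definition flip_class :: "nat \<Rightarrow> nat rel set \<Rightarrow> nat rel set" where
  "flip_class n C = iso_rel n `` {flip_order {..<n} (SOME R. R \<in> C)}"

lemma interval_orders_mem:
  assumes "C \<in> interval_orders n" "R \<in> C"
  shows "interval_order_on {..<n} R" "C = iso_rel n `` {R}"
proof -
  show "interval_order_on {..<n} R"
    using assms in_quotient_imp_subset[OF equiv_iso_rel] unfolding interval_orders_def by blast
  obtain R0 where "C = iso_rel n `` {R0}" using assms(1) unfolding interval_orders_def
    by (rule quotientE)
  then show "C = iso_rel n `` {R}" using assms(2) equiv_class_eq[OF equiv_iso_rel] by auto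
qed

lemma interval_orders_nonempty: "C \<in> interval_orders n \<Longrightarrow> \<exists>R. R \<in> C"
  using in_quotient_imp_non_empty[OF equiv_iso_rel] unfolding interval_orders_def by blast

lemma flip_order_interval_order:
  fixes R :: "nat rel"
  assumes "interval_order_on {..<n} R"
  shows "interval_order_on {..<n} (flip_order {..<n} R)"
    and "flip_order {..<n} (flip_order {..<n} R) = R"
proof -
  obtain m l r where rep: "minimal_interval_rep {..<n} R m l r"
    using minimal_interval_rep_exists[OF _ assms] by blast
  show "interval_order_on {..<n} (flip_order {..<n} R)"
    using interval_order_on_rep[OF minimal_interval_rep_flip flip_order_subset] rep by blast
  show "flip_order {..<n} (flip_order {..<n} R) = R"
    using flip_order_flip_order[OF rep] assms by (simp add: interval_order_on_def)
qed

lemma flip_class_eq: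
  assumes "C \<in> interval_orders n" "R \<in> C"
  shows "flip_class n C = iso_rel n `` {flip_order {..<n} R}"
proof -
  have "(SOME R. R \<in> C) \<in> C" using assms(2) by (rule someI)
  then have "(R, SOME R. R \<in> C) \<in> iso_rel n" using interval_orders_mem(2)[OF assms] by blast
  then show ?thesis
    unfolding flip_class_def using equiv_class_eq[OF equiv_iso_rel flip_order_iso] by blast
qed

lemma flip_class_involution:
  assumes "C \<in> interval_orders n"
  shows "flip_class n C \<in> interval_orders n" "flip_class n (flip_class n C) = C"
proof -
  obtain R where R: "R \<in> C" using interval_orders_nonempty assms by blast
  note io = flip_order_interval_order[OF interval_orders_mem(1)[OF assms R]]
  note eq = flip_class_eq[OF assms R]
  show mem: "flip_class n C \<in> interval_orders n"
    unfolding eq interval_orders_def using io(1) by (intro quotientI) simp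
  have "flip_order {..<n} R \<in> flip_class n C"
    unfolding eq using io(1) by (intro equiv_class_self[OF equiv_iso_rel]) simp
  from flip_class_eq[OF mem this] show "flip_class n (flip_class n C) = C"
    using io(2) interval_orders_mem(2)[OF assms R] by simp
qed

lemma num_maximal_flip_class:
  assumes C: "C \<in> interval_orders n" "R \<in> C" "R' \<in> flip_class n C"
    and F: "F1_triple {..<n} T1 S1 R" "F2_triple {..<n} T2 S2 R"
      "F1_triple {..<n} T1' S1' R'" "F2_triple {..<n} T2' S2' R'"
  shows "num_maximal {..<n} S1 = num_maximal {..<n} T2' \<and>
    num_maximal {..<n} T2 = num_maximal {..<n} S1' \<and>
    num_maximal {..<n} S2 = num_maximal {..<n} T1' \<and>
    num_maximal {..<n} T1 = num_maximal {..<n} S2' \<and>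
    num_maximal {..<n} R = num_maximal {..<n} R'"
proof (rule num_maximal_flip_order[OF _ _ F])
  show "interval_order_on {..<n} R" using interval_orders_mem C by blast
  have "(flip_order {..<n} R, R') \<in> iso_rel n" using flip_class_eq C by blast
  then show "(R', flip_order {..<n} R) \<in> iso_rel n"
    using equiv_iso_rel by (auto simp: equiv_def dest: symD)
qed

text \<open>Well-definedness of the statistics comes from the flip itself: one order in the flipped
  class is fixed together with its triples, and the values for every representative of
  \<open>C\<close> and every choice of linear orders equal those of the fixed triples.\<close>

lemma max_statistics_eq:
  assumes C: "C \<in> interval_orders n" and R: "R \<in> C"
    and F: "F1_triple {..<n} T1 S1 R" "F2_triple {..<n} T2 S2 R"
  shows "max_S1 n C = num_maximal {..<n} S1" "max_T1 n C = num_maximal {..<n} T1"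
    "max_S2 n C = num_maximal {..<n} S2" "max_T2 n C = num_maximal {..<n} T2"
proof -
  obtain R' where R': "R' \<in> flip_class n C"
    using interval_orders_nonempty flip_class_involution(1)[OF C] by blast
  then have "interval_order_on {..<n} R'"
    using interval_orders_mem(1)[OF flip_class_involution(1)[OF C]] by blast
  then obtain T1' S1' T2' S2'
    where F': "F1_triple {..<n} T1' S1' R'" "F2_triple {..<n} T2' S2' R'"
    using F1_F2_triple_exist by meson
  note eq = num_maximal_flip_class[OF C R R' F F']
  have F1: "num_maximal {..<n} S = num_maximal {..<n} T2' \<and>
      num_maximal {..<n} T = num_maximal {..<n} S2'"
    if "Ra \<in> C" "F1_triple {..<n} T S Ra" for Ra T S
    using num_maximal_flip_class[OF C that(1) R' that(2) _ F'] F1_F2_triple_exist(2)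
      interval_orders_mem(1)[OF C that(1)] by blast
  have F2: "num_maximal {..<n} T = num_maximal {..<n} S1' \<and>
      num_maximal {..<n} S = num_maximal {..<n} T1'"
    if "Ra \<in> C" "F2_triple {..<n} T S Ra" for Ra T S
    using num_maximal_flip_class[OF C that(1) R' _ that(2) F'] F1_F2_triple_exist(1)
      interval_orders_mem(1)[OF C that(1)] by blast
  show "max_S1 n C = num_maximal {..<n} S1"
    unfolding max_S1_def by (rule the_equality) (use R F F1 in \<open>blast, metis\<close>)
  show "max_T1 n C = num_maximal {..<n} T1"
    unfolding max_T1_def by (rule the_equality) (use R F F1 in \<open>blast, metis\<close>)
  show "max_S2 n C = num_maximal {..<n} S2"
    unfolding max_S2_def by (rule the_equality) (use R F F2 in \<open>blast, metis\<close>)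
  show "max_T2 n C = num_maximal {..<n} T2"
    unfolding max_T2_def by (rule the_equality) (use R F F2 in \<open>blast, metis\<close>)
qed

lemma max_statistics_flip_class:
  assumes C: "C \<in> interval_orders n"
  shows "max_S1 n C = max_T2 n (flip_class n C)" "max_T2 n C = max_S1 n (flip_class n C)"
    "max_S2 n C = max_T1 n (flip_class n C)" "max_T1 n C = max_S2 n (flip_class n C)"
proof -
  note C' = flip_class_involution(1)[OF C]
  obtain R R' where R: "R \<in> C" and R': "R' \<in> flip_class n C"
    using interval_orders_nonempty C C' by blast
  obtain T1 S1 T2 S2 T1' S1' T2' S2'
    where F: "F1_triple {..<n} T1 S1 R" "F2_triple {..<n} T2 S2 R"
      and F': "F1_triple {..<n} T1' S1' R'" "F2_triple {..<n} T2' S2' R'"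
    using F1_F2_triple_exist interval_orders_mem(1)[OF C R] interval_orders_mem(1)[OF C' R']
    by meson
  show "max_S1 n C = max_T2 n (flip_class n C)" "max_T2 n C = max_S1 n (flip_class n C)"
    "max_S2 n C = max_T1 n (flip_class n C)" "max_T1 n C = max_S2 n (flip_class n C)"
    using max_statistics_eq[OF C R F] max_statistics_eq[OF C' R' F']
      num_maximal_flip_class[OF C R R' F F'] by simp_all
qed

text \<open>The involution exchanges the two statistics, so it restricts to a bijection between the
  two level sets, with itself as the inverse.\<close>

lemma symmetric_joint_distribution_involution:
  assumes "\<And>a. a \<in> \<A> \<Longrightarrow> \<phi> a \<in> \<A>" "\<And>a. a \<in> \<A> \<Longrightarrow> \<phi> (\<phi> a) = a"
    and "\<And>a. a \<in> \<A> \<Longrightarrow> f a = g (\<phi> a)" "\<And>a. a \<in> \<A> \<Longrightarrow> g a = f (\<phi> a)"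
  shows "symmetric_joint_distribution \<A> f g"
  unfolding symmetric_joint_distribution_def
proof (intro allI)
  fix k l
  have "bij_betw \<phi> {a \<in> \<A>. f a = k \<and> g a = l} {a \<in> \<A>. f a = l \<and> g a = k}"
    by (rule bij_betw_byWitness[where f' = \<phi>]) (use assms in auto)
  then show "card {a \<in> \<A>. f a = k \<and> g a = l} = card {a \<in> \<A>. f a = l \<and> g a = k}"
    by (rule bij_betw_same_card)
qed

theorem theorem3p6:
  fixes n :: nat
  shows
    "(\<exists>\<phi> :: nat rel set \<Rightarrow> nat rel set.
        (\<forall>C \<in> interval_orders n. \<phi> C \<in> interval_orders n \<and> \<phi> (\<phi> C) = C) \<and>
        (\<forall>C \<in> interval_orders n. \<forall>R \<in> C. \<forall>R' \<in> \<phi> C.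
           \<forall>T\<^sub>1 S\<^sub>1 T\<^sub>2 S\<^sub>2 T\<^sub>1' S\<^sub>1' T\<^sub>2' S\<^sub>2'.
             F1_triple {..<n} T\<^sub>1 S\<^sub>1 R \<and> F2_triple {..<n} T\<^sub>2 S\<^sub>2 R \<and>
             F1_triple {..<n} T\<^sub>1' S\<^sub>1' R' \<and> F2_triple {..<n} T\<^sub>2' S\<^sub>2' R' \<longrightarrow>
               num_maximal {..<n} S\<^sub>1 = num_maximal {..<n} T\<^sub>2' \<and>
               num_maximal {..<n} T\<^sub>2 = num_maximal {..<n} S\<^sub>1' \<and>
               num_maximal {..<n} S\<^sub>2 = num_maximal {..<n} T\<^sub>1' \<and>
               num_maximal {..<n} T\<^sub>1 = num_maximal {..<n} S\<^sub>2' \<and>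
               num_maximal {..<n} R = num_maximal {..<n} R')) \<and>
     symmetric_joint_distribution (interval_orders n) (max_S1 n) (max_T2 n) \<and>
     symmetric_joint_distribution (interval_orders n) (max_S2 n) (max_T1 n)"
proof (intro conjI)
  show "\<exists>\<phi> :: nat rel set \<Rightarrow> nat rel set.
      (\<forall>C \<in> interval_orders n. \<phi> C \<in> interval_orders n \<and> \<phi> (\<phi> C) = C) \<and>
      (\<forall>C \<in> interval_orders n. \<forall>R \<in> C. \<forall>R' \<in> \<phi> C.
         \<forall>T\<^sub>1 S\<^sub>1 T\<^sub>2 S\<^sub>2 T\<^sub>1' S\<^sub>1' T\<^sub>2' S\<^sub>2'.
           F1_triple {..<n} T\<^sub>1 S\<^sub>1 R \<and> F2_triple {..<n} T\<^sub>2 S\<^sub>2 R \<and>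
           F1_triple {..<n} T\<^sub>1' S\<^sub>1' R' \<and> F2_triple {..<n} T\<^sub>2' S\<^sub>2' R' \<longrightarrow>
             num_maximal {..<n} S\<^sub>1 = num_maximal {..<n} T\<^sub>2' \<and>
             num_maximal {..<n} T\<^sub>2 = num_maximal {..<n} S\<^sub>1' \<and>
             num_maximal {..<n} S\<^sub>2 = num_maximal {..<n} T\<^sub>1' \<and>
             num_maximal {..<n} T\<^sub>1 = num_maximal {..<n} S\<^sub>2' \<and>
             num_maximal {..<n} R = num_maximal {..<n} R')"
    by (rule exI[of _ "flip_class n"], intro conjI[OF ballI ballI] ballI allI impI)
      (intro conjI flip_class_involution, assumption+, elim conjE, rule num_maximal_flip_class)
  show "symmetric_joint_distribution (interval_orders n) (max_S1 n) (max_T2 n)"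
    by (rule symmetric_joint_distribution_involution[where \<phi> = "flip_class n"])
      (erule flip_class_involution max_statistics_flip_class)+
  show "symmetric_joint_distribution (interval_orders n) (max_S2 n) (max_T1 n)"
    by (rule symmetric_joint_distribution_involution[where \<phi> = "flip_class n"])
      (erule flip_class_involution max_statistics_flip_class)+
qed

end
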